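(* Let $\gamma \geq 0$. If $\psi$ belongs to the Sobolev space $\mathbf{W}^{2,\gamma}(\mathbf{R})$, then its Hilbert transform $\mathcal{H}\psi$ belongs to $\mathbf{W}^{2,\gamma}(\mathbf{R})$. In particular, if $n \geq 0$ is an integer and $\gamma > n + 1/2$, then both $\psi$ and $\mathcal{H}\psi$ are equal almost everywhere to functions that are $n$-times continuously differentiable on $\mathbf{R}$.
   Context: The Fourier transform is $\hat f(\omega) = \int_{-\infty}^{\infty} f(x) e^{-j\omega x}\,dx$ (with $j^2=-1$), extended to $\mathrm{L}^2(\mathbf{R})$ in the usual way. For $f \in \mathrm{L}^2(\mathbf{R})$ the Hilbert transform $\mathcal{H}f \in \mathrm{L}^2(\mathbf{R})$ is the function specified by $$\widehat{\mathcal{H}f}(\omega) = \begin{cases} -j\hat f(\omega) & \omega > 0,\\ +j \hat f(\omega) & \omega < 0,\\ 0 & \omega = 0.\end{cases}$$ For $\gamma \geq 0$, a function $f \in \mathrm{L}^2(\mathbf{R})$ belongs to the Sobolev space $\mathbf{W}^{2,\gamma}(\mathbf{R})$ if $$\int_{-\infty}^{\infty} (1+|\omega|^2)^\gamma |\hat f(\omega)|^2\,d\omega < \infty.$$ A function is $n$-times continuously differentiable if all its derivatives up to order $n$ exist and are continuous. *)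

theory Defs
  imports "HOL-Analysis.Analysis"
begin

text \<open>
  Elements of $L^p(\mathbf{R})$ are represented by Lebesgue measurable functions; equality of
  such elements is equality almost everywhere.
\<close>

definition L1 :: "(real \<Rightarrow> complex) set" where
  "L1 = {f. integrable lebesgue f}"

definition L2 :: "(real \<Rightarrow> complex) set" where
  "L2 = {f. f \<in> borel_measurable lebesgue \<and> integrable lebesgue (\<lambda>x. (norm (f x))\<^sup>2)}"

text \<open>
  The distance is an extended nonnegative integral, so that it is infinite, rather than 0,
  when the difference is not square integrable.
\<close>

definition L2_tendsto :: "(nat \<Rightarrow> real \<Rightarrow> complex) \<Rightarrow> (real \<Rightarrow> complex) \<Rightarrow> bool" where
  "L2_tendsto u f \<longleftrightarrow>
     (\<lambda>n. \<integral>\<^sup>+x. ennreal ((norm (u n x - f x))\<^sup>2) \<partial>lebesgue) \<longlonglongrightarrow> 0"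

definition fourier_integral :: "(real \<Rightarrow> complex) \<Rightarrow> real \<Rightarrow> complex" where
  "fourier_integral f \<omega> =
     (LINT x|lebesgue. f x * exp (- \<i> * complex_of_real \<omega> * complex_of_real x))"

text \<open>
  The extension to $L^2(\mathbf{R})$ by density of $L^1(\mathbf{R}) \cap L^2(\mathbf{R})$ and
  continuity. That such a function exists and is unique almost everywhere is Plancherel's theorem;
  the choice below only selects a representative of the class.
\<close>

definition is_fourier_transform :: "(real \<Rightarrow> complex) \<Rightarrow> (real \<Rightarrow> complex) \<Rightarrow> bool" where
  "is_fourier_transform f g \<longleftrightarrow> f \<in> L2 \<and> g \<in> L2 \<and>
     (\<exists>u. (\<forall>n. u n \<in> L1 \<inter> L2) \<and> L2_tendsto u f \<and>
          L2_tendsto (\<lambda>n. fourier_integral (u n)) g)"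

definition fourier_transform :: "(real \<Rightarrow> complex) \<Rightarrow> real \<Rightarrow> complex" where
  "fourier_transform f = (SOME g. is_fourier_transform f g)"

text \<open>
  Here too the choice only selects a representative: a function in $L^2(\mathbf{R})$ is determined
  almost everywhere by its Fourier transform, and every function in $L^2(\mathbf{R})$ is a
  Fourier transform.
\<close>

definition is_hilbert_transform :: "(real \<Rightarrow> complex) \<Rightarrow> (real \<Rightarrow> complex) \<Rightarrow> bool" where
  "is_hilbert_transform f h \<longleftrightarrow> f \<in> L2 \<and> h \<in> L2 \<and>
     (AE \<omega> in lebesgue. fourier_transform h \<omega> =
        (if \<omega> > 0 then - \<i> * fourier_transform f \<omega>
         else if \<omega> < 0 then \<i> * fourier_transform f \<omega>
         else 0))"

definition hilbert_transform :: "(real \<Rightarrow> complex) \<Rightarrow> real \<Rightarrow> complex" where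
  "hilbert_transform f = (SOME h. is_hilbert_transform f h)"

definition sobolev :: "real \<Rightarrow> (real \<Rightarrow> complex) set" where
  "sobolev \<gamma> = {f \<in> L2.
     (\<integral>\<^sup>+\<omega>. ennreal ((1 + \<bar>\<omega>\<bar>\<^sup>2) powr \<gamma> * (norm (fourier_transform f \<omega>))\<^sup>2) \<partial>lebesgue) < \<infinity>}"

definition n_times_continuously_differentiable :: "nat \<Rightarrow> (real \<Rightarrow> complex) \<Rightarrow> bool" where
  "n_times_continuously_differentiable n f \<longleftrightarrow>
     (\<exists>D. D 0 = f \<and>
        (\<forall>k<n. \<forall>x. (D k has_vector_derivative D (Suc k) x) (at x)) \<and>
        (\<forall>k\<le>n. continuous_on UNIV (D k)))"

end

theory Submission
  imports Defs "HOL-Probability.Probability"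
begin

text \<open>
  On the Fourier side the Hilbert transform multiplies by \<open>-\<i>\<close> or \<open>\<i>\<close> (and by \<open>0\<close> at the origin), so
  it does not increase the modulus of the Fourier transform; therefore the weighted integral that
  defines the Sobolev space stays finite (lemma \<open>hilbert_transform_sobolev\<close>). If
  \<open>\<gamma> > n + 1/2\<close>, the weight gives integrability of \<open>\<omega>\<^sup>k\<close> times the Fourier transform for
  \<open>k \<le> n\<close> (lemma \<open>sobolev_moment_L1\<close>). The Fourier inversion formula then
  represents the function almost everywhere by an absolutely convergent integral that can be
  differentiated \<open>n\<close> times under the integral sign (lemma \<open>sobolev_embedding\<close>).

  Both arguments presuppose the \<open>L\<^sup>2\<close> theory of the Fourier transform: that every \<open>f\<close> has a transform,
  that it is unique almost everywhere, that every element of \<open>L\<^sup>2\<close> is a transform, and that the inversion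
  formula holds for integrable transforms. Everything rests on the duality
  \<open>\<integral> F u \<cdot> v = \<integral> u \<cdot> F v\<close>, where \<open>F\<close> is the Fourier integral on \<open>L\<^sup>1\<close>, and on explicit transforms of
  Gaussian wave packets.

  \<^item> Only the inequality \<open>\<parallel>F u\<parallel>\<^sup>2 \<le> 2\<pi> \<parallel>u\<parallel>\<^sup>2\<close> is proved (\<open>plancherel_le\<close>), not the identity. It makes the
    transforms of the truncations of \<open>f\<close> a Cauchy sequence, and the completeness of \<open>L\<^sup>2\<close>
    (\<open>L2_complete_geometric\<close>) gives existence.
  \<^item> Duality extends to \<open>L\<^sup>2\<close> transforms tested against functions in \<open>L\<^sup>1 \<inter> L\<^sup>2\<close>
    (\<open>is_fourier_transform_duality\<close>). Testing against enough functions gives uniqueness.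
  \<^item> Testing against wave packets turns an orthogonality relation into the vanishing of the Fourier
    integral of an \<open>L\<^sup>1\<close> function, which vanishes almost everywhere by Levy's uniqueness theorem for
    characteristic functions (\<open>L1_fourier_zero_imp_zero\<close>). This gives injectivity, and it
    identifies the conjugate of the transform of the conjugate, divided by \<open>2\<pi>\<close>, as the inverse
    transform (\<open>is_fourier_transform_inverse\<close>), hence surjectivity and the inversion formula.
\<close>

section \<open>The Fourier integral and its duality\<close>

lemma sigma_finite_lebesgue: "sigma_finite_measure (lebesgue :: real measure)"
proof -
  obtain A :: "real set set" where "countable A" "A \<subseteq> sets lborel" "\<Union>A = space lborel"
    "\<forall>a\<in>A. emeasure lborel a \<noteq> \<infinity>"
    using lborel.sigma_finite_countable by blast
  then show ?thesis
    by (intro sigma_finite_measure.intro exI[of _ A]) auto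
qed

interpretation lebesgue: sigma_finite_measure "lebesgue :: real measure"
  by (rule sigma_finite_lebesgue)

interpretation lebesgue_pair: pair_sigma_finite "lebesgue :: real measure" "lebesgue :: real measure" ..

lemma borel_imp_lebesgue_measurable:
  "f \<in> borel_measurable borel \<Longrightarrow> f \<in> borel_measurable lebesgue"
  by (simp add: measurable_completion)

lemma measurable_ident_lebesgue: "(\<lambda>x. x) \<in> lebesgue \<rightarrow>\<^sub>M borel"
  by (rule borel_imp_lebesgue_measurable) simp

lemma borel_measurable_cnj:
  "f \<in> borel_measurable M \<Longrightarrow> (\<lambda>x. cnj (f x)) \<in> borel_measurable M"
  by (rule borel_measurable_continuous_on[where f = cnj]) (intro continuous_intros)

lemma L1_measurable: "f \<in> L1 \<Longrightarrow> f \<in> borel_measurable lebesgue"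
  by (auto simp: L1_def)

lemma L2_measurable: "f \<in> L2 \<Longrightarrow> f \<in> borel_measurable lebesgue"
  by (auto simp: L2_def)

lemma integrable_L1_mult_bounded:
  assumes f: "f \<in> L1" and [measurable]: "g \<in> borel_measurable lebesgue"
    and "\<And>x. norm (g x) \<le> B"
  shows "integrable lebesgue (\<lambda>x. f x * g x)"
proof (rule Bochner_Integration.integrable_bound[where f = "\<lambda>x. B * norm (f x)"])
  have [measurable]: "f \<in> borel_measurable lebesgue" using f by (rule L1_measurable)
  show "integrable lebesgue (\<lambda>x. B * norm (f x))"
    using f by (auto simp: L1_def)
  show "(\<lambda>x. f x * g x) \<in> borel_measurable lebesgue" by simp
  have "0 \<le> B" using assms(3)[of 0] norm_ge_zero order_trans by blast
  then show "AE x in lebesgue. norm (f x * g x) \<le> norm (B * norm (f x))"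
    using assms(3) by (intro AE_I2) (simp add: norm_mult mult.commute[of B] mult_left_mono)
qed

lemma integrable_fourier:
  "f \<in> L1 \<Longrightarrow> integrable lebesgue (\<lambda>x. f x * exp (- \<i> * complex_of_real w * complex_of_real x))"
  by (rule integrable_L1_mult_bounded[where B=1]) (auto intro!: borel_imp_lebesgue_measurable)

lemma norm_fourier_integral_le:
  assumes f: "f \<in> L1"
  shows "norm (fourier_integral f w) \<le> (LINT x|lebesgue. norm (f x))"
  unfolding fourier_integral_def
  by (rule order_trans[OF integral_norm_bound]) (simp add: norm_mult)

lemma fourier_integral_measurable:
  assumes f: "f \<in> L1"
  shows "fourier_integral f \<in> borel_measurable lebesgue"
proof -
  have [measurable]: "f \<in> borel_measurable lebesgue" using f by (rule L1_measurable)
  note measurable_ident_lebesgue [measurable]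
  show ?thesis
    unfolding fourier_integral_def [abs_def] by measurable
qed

text \<open>
  Both sides are iterated integrals of the integrable function
  \<open>f x \<cdot> g w \<cdot> exp (-\<i> w x)\<close>, whose kernel is symmetric in the two variables.
\<close>
lemma fourier_duality:
  assumes f: "f \<in> L1" and g: "g \<in> L1"
  shows "(LINT w|lebesgue. fourier_integral f w * g w) = (LINT x|lebesgue. f x * fourier_integral g x)"
proof -
  have [measurable]: "f \<in> borel_measurable lebesgue" "g \<in> borel_measurable lebesgue"
    using assms by (auto intro: L1_measurable)
  note measurable_ident_lebesgue [measurable]
  let ?k = "\<lambda>x w. f x * g w * exp (- \<i> * complex_of_real w * complex_of_real x)"
  have "integrable (lebesgue \<Otimes>\<^sub>M lebesgue) (case_prod ?k)"
  proof (rule lebesgue_pair.Fubini_integrable)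
    show "case_prod ?k \<in> borel_measurable (lebesgue \<Otimes>\<^sub>M lebesgue)" by measurable
    show "integrable lebesgue (\<lambda>x. LINT w|lebesgue. norm (case_prod ?k (x, w)))"
      using f by (simp add: norm_mult L1_def)
    show "AE x in lebesgue. integrable lebesgue (\<lambda>w. case_prod ?k (x, w))"
    proof (rule AE_I2)
      fix x :: real
      have "integrable lebesgue (\<lambda>w. f x * (g w * exp (- \<i> * complex_of_real x * complex_of_real w)))"
        by (intro integrable_mult_right integrable_fourier g)
      then show "integrable lebesgue (\<lambda>w. case_prod ?k (x, w))"
        by (simp add: mult_ac)
    qed
  qed
  then have "(LINT w|lebesgue. LINT x|lebesgue. ?k x w) = (LINT x|lebesgue. LINT w|lebesgue. ?k x w)"
    by (rule lebesgue_pair.Fubini_integral)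
  moreover have "(LINT x|lebesgue. ?k x w) = fourier_integral f w * g w" for w
    unfolding fourier_integral_def by (subst integral_mult_left_zero[symmetric]) (simp add: mult_ac)
  moreover have "(LINT w|lebesgue. ?k x w) = f x * fourier_integral g x" for x
    unfolding fourier_integral_def by (subst integral_mult_right_zero[symmetric]) (simp add: mult_ac)
  ultimately show ?thesis by simp
qed

section \<open>Gaussian wave packets\<close>

lemma L2I_bounded:
  assumes f: "f \<in> L1" and b: "\<And>x. norm (f x) \<le> B"
  shows "f \<in> L2"
proof -
  have [measurable]: "f \<in> borel_measurable lebesgue" using f by (rule L1_measurable)
  have "integrable lebesgue (\<lambda>x. norm (f x * f x))"
    by (intro integrable_norm integrable_L1_mult_bounded[OF f _ b]) simp
  then show ?thesis by (simp add: L2_def norm_mult power2_eq_square)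
qed

text \<open>
  A Gaussian of width \<open>s\<close> centred at \<open>b\<close>, modulated to the frequency \<open>a\<close>. The Fourier integral maps
  this family to itself up to constants, which makes it a convenient class of test functions.
\<close>
definition wave_packet :: "real \<Rightarrow> real \<Rightarrow> real \<Rightarrow> real \<Rightarrow> complex" where
  "wave_packet b s a x =
     complex_of_real (exp (- ((x - b) / s)\<^sup>2 / 2)) * exp (\<i> * complex_of_real a * complex_of_real x)"

lemma wave_packet_measurable [measurable]: "wave_packet b s a \<in> borel_measurable borel"
  unfolding wave_packet_def [abs_def] by measurable

lemma norm_wave_packet: "norm (wave_packet b s a x) = exp (- ((x - b) / s)\<^sup>2 / 2)"
  by (simp add: wave_packet_def norm_mult)

lemma wave_packet_L1:
  assumes "s > 0"
  shows "wave_packet b s a \<in> L1"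
proof -
  have "integrable lborel (\<lambda>x. sqrt (2 * pi * s\<^sup>2) * normal_density b s x)"
    using assms by simp
  also have "(\<lambda>x. sqrt (2 * pi * s\<^sup>2) * normal_density b s x) = (\<lambda>x. norm (wave_packet b s a x))"
    using assms by (simp add: normal_density_def norm_wave_packet power_divide fun_eq_iff)
  finally have "integrable lborel (wave_packet b s a)"
    by (subst (asm) integrable_norm_iff) simp_all
  then show ?thesis by (simp add: L1_def integrable_completion)
qed

lemma wave_packet_L2: "s > 0 \<Longrightarrow> wave_packet b s a \<in> L2"
  by (rule L2I_bounded[OF wave_packet_L1, where B=1]) (auto simp: norm_wave_packet)

text \<open>
  This is the characteristic function of the standard normal distribution, without the
  normalization of the density.
\<close>
lemma fourier_standard_gaussian:
  "(LINT x|lborel. complex_of_real (exp (- x\<^sup>2 / 2)) * exp (- \<i> * complex_of_real w * complex_of_real x))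
     = complex_of_real (sqrt (2 * pi) * exp (- w\<^sup>2 / 2))"
proof -
  have "complex_of_real (exp (- w\<^sup>2 / 2)) = char std_normal_distribution (- w)"
    by (simp add: char_std_normal_distribution)
  also have "\<dots> = (LINT x|lborel. std_normal_density x *\<^sub>R exp (\<i> * complex_of_real (- w * x)))"
    unfolding char_def by (subst integral_density) (auto)
  also have "\<dots> = (LINT x|lborel. complex_of_real (1 / sqrt (2 * pi)) *
      (complex_of_real (exp (- x\<^sup>2 / 2)) * exp (- \<i> * complex_of_real w * complex_of_real x)))"
    by (intro Bochner_Integration.integral_cong refl)
       (simp add: std_normal_density_def scaleR_conv_of_real mult_ac)
  also have "\<dots> = complex_of_real (1 / sqrt (2 * pi)) *
      (LINT x|lborel. complex_of_real (exp (- x\<^sup>2 / 2)) * exp (- \<i> * complex_of_real w * complex_of_real x))"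
    by (rule integral_mult_right_zero)
  finally show ?thesis by (simp add: field_simps)
qed

text \<open>
  The substitution \<open>x = b + s t\<close> reduces the integral to the standard Gaussian at the frequency
  \<open>s (w - a)\<close>.
\<close>
lemma fourier_wave_packet:
  assumes s: "s > 0"
  shows "fourier_integral (wave_packet b s a) w =
    complex_of_real (s * sqrt (2 * pi) * exp (- (s * (w - a))\<^sup>2 / 2)) *
      exp (- \<i> * complex_of_real (w - a) * complex_of_real b)"
proof -
  let ?f = "\<lambda>x. wave_packet b s a x * exp (- \<i> * complex_of_real w * complex_of_real x)"
  let ?e = "exp (- \<i> * complex_of_real (w - a) * complex_of_real b)"
  have "fourier_integral (wave_packet b s a) w = (LINT x|lborel. ?f x)"
    unfolding fourier_integral_def by (rule integral_completion) simp
  also have "\<dots> = s *\<^sub>R (LINT x|lborel. ?f (b + s * x))"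
    using s by (subst lborel_integral_real_affine[where c=s and t=b]) auto
  also have "(LINT x|lborel. ?f (b + s * x)) = (LINT x|lborel. ?e * (complex_of_real (exp (- x\<^sup>2 / 2)) *
      exp (- \<i> * complex_of_real (s * (w - a)) * complex_of_real x)))"
  proof (intro Bochner_Integration.integral_cong refl)
    fix x
    have "?f (b + s * x) = complex_of_real (exp (- x\<^sup>2 / 2)) * (exp (\<i> * complex_of_real a * complex_of_real (b + s * x)) * exp (- \<i> * complex_of_real w * complex_of_real (b + s * x)))"
      using s by (simp add: wave_packet_def)
    also have "exp (\<i> * complex_of_real a * complex_of_real (b + s * x)) * exp (- \<i> * complex_of_real w * complex_of_real (b + s * x))
       = ?e * exp (- \<i> * complex_of_real (s * (w - a)) * complex_of_real x)"
      unfolding exp_add[symmetric] by (rule arg_cong[where f=exp]) (simp add: algebra_simps)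
    finally show "?f (b + s * x) = ?e * (complex_of_real (exp (- x\<^sup>2 / 2)) *
      exp (- \<i> * complex_of_real (s * (w - a)) * complex_of_real x))" by (simp only: mult_ac)
  qed
  also have "\<dots> = ?e * complex_of_real (sqrt (2 * pi) * exp (- (s * (w - a))\<^sup>2 / 2))"
    by (simp only: integral_mult_right_zero fourier_standard_gaussian)
  finally show ?thesis by (simp add: scaleR_conv_of_real mult_ac)
qed

section \<open>The Plancherel inequality\<close>

text \<open>
  With a Gaussian weight all integrals converge. Writing \<open>|F u|\<^sup>2\<close> as \<open>F u\<close> times its conjugate and using
  duality twice, the left side becomes the double integral of \<open>u x\<close> times the conjugate of \<open>u y\<close>
  against \<open>2\<pi>\<close> times a normal density in \<open>y\<close> with mean \<open>x\<close>. Since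
  \<open>|u x| |u y| \<le> (|u x|\<^sup>2 + |u y|\<^sup>2) / 2\<close> and the density is symmetric with total mass \<open>1\<close>, the bound follows,
  uniformly in the width \<open>s\<close>.
\<close>
lemma weighted_plancherel_le:
  assumes u1: "u \<in> L1" and s: "s > 0"
  shows "(\<integral>\<^sup>+w. ennreal (exp (- (w / s)\<^sup>2 / 2) * (norm (fourier_integral u w))\<^sup>2) \<partial>lebesgue)
    \<le> ennreal (2 * pi) * (\<integral>\<^sup>+x. ennreal ((norm (u x))\<^sup>2) \<partial>lebesgue)"
proof -
  define W where "W = wave_packet 0 s 0"
  have W: "W w = complex_of_real (exp (- (w / s)\<^sup>2 / 2))" for w
    by (simp add: W_def wave_packet_def)
  define v where "v = (\<lambda>w. W w * cnj (fourier_integral u w))"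
  \<comment> \<open>The transform of the weight, modulated to the frequency \<open>x\<close>, at \<open>y\<close>.\<close>
  define k where "k x y = 2 * pi * normal_density x (1 / s) y" for x y
  have k_nonneg [simp]: "0 \<le> k x y" for x y by (simp add: k_def)
  have k_sym: "k x y = k y x" for x y by (simp add: k_def normal_density_def power2_commute)
  have [measurable]: "case_prod k \<in> borel_measurable (borel \<Otimes>\<^sub>M borel)"
    unfolding k_def normal_density_def by measurable
  have k_int: "(\<integral>\<^sup>+y. ennreal (k x y) \<partial>lebesgue) = ennreal (2 * pi)" for x
    using s unfolding k_def nn_integral_completion
    by (subst nn_integral_eq_integral) auto
  have [measurable]: "u \<in> borel_measurable lebesgue" "fourier_integral u \<in> borel_measurable lebesgue"
    using u1 by (auto intro: L1_measurable fourier_integral_measurable)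
  note measurable_ident_lebesgue [measurable]
  have [measurable]: "W \<in> borel_measurable lebesgue"
    unfolding W_def by (rule borel_imp_lebesgue_measurable) measurable
  have v1: "v \<in> L1"
    unfolding v_def W_def L1_def mem_Collect_eq
  proof (rule integrable_L1_mult_bounded[OF wave_packet_L1[OF s]])
    show "(\<lambda>w. cnj (fourier_integral u w)) \<in> borel_measurable lebesgue"
      by (rule borel_measurable_cnj) fact
    show "norm (cnj (fourier_integral u w)) \<le> (LINT x|lebesgue. norm (u x))" for w
      using norm_fourier_integral_le[OF u1] by simp
  qed
  have Fv: "fourier_integral v x = cnj (LINT y|lebesgue. u y * complex_of_real (k x y))" for x
  proof -
    have "fourier_integral v x = (LINT w|lebesgue. cnj (fourier_integral u w * wave_packet 0 s x w))"
      unfolding fourier_integral_def[of v]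
      by (intro Bochner_Integration.integral_cong refl)
         (simp add: v_def W_def wave_packet_def exp_cnj mult_ac)
    also have "\<dots> = cnj (LINT w|lebesgue. fourier_integral u w * wave_packet 0 s x w)"
      by (rule Bochner_Integration.integral_cnj)
    also have "(LINT w|lebesgue. fourier_integral u w * wave_packet 0 s x w) =
        (LINT y|lebesgue. u y * fourier_integral (wave_packet 0 s x) y)"
      by (rule fourier_duality[OF u1 wave_packet_L1[OF s]])
    also have "\<dots> = (LINT y|lebesgue. u y * complex_of_real (k x y))"
    proof (intro Bochner_Integration.integral_cong refl)
      fix y
      define r where "r = sqrt (2 * pi)"
      have r: "r > 0" "2 * pi = r * r" by (simp_all add: r_def)
      have "sqrt (2 * pi * (1 / s)\<^sup>2) = r / s"
        using s by (simp add: real_sqrt_mult real_sqrt_divide r_def)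
      moreover have "- (y - x)\<^sup>2 / (2 * (1 / s)\<^sup>2) = - (s * (y - x))\<^sup>2 / 2"
        using s by (simp add: power_mult_distrib power_divide)
      moreover have "2 * pi * (1 / (r / s)) = s * r"
        using s r(1) unfolding r(2) by simp
      ultimately have "k x y = s * sqrt (2 * pi) * exp (- (s * (y - x))\<^sup>2 / 2)"
        unfolding k_def normal_density_def r_def by (simp only: mult.assoc[symmetric])
      then show "u y * fourier_integral (wave_packet 0 s x) y = u y * complex_of_real (k x y)"
        by (simp add: fourier_wave_packet[OF s])
    qed
    finally show ?thesis .
  qed
  have nFv: "ennreal (norm (fourier_integral v x)) \<le> (\<integral>\<^sup>+y. ennreal (norm (u y) * k x y) \<partial>lebesgue)" for x
  proof -
    have "integrable lebesgue (\<lambda>y. u y * complex_of_real (k x y))"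
    proof (rule integrable_L1_mult_bounded[OF u1])
      show "(\<lambda>y. complex_of_real (k x y)) \<in> borel_measurable lebesgue" by measurable
      show "cmod (complex_of_real (k x y)) \<le> 2 * pi * (1 / sqrt (2 * pi * (1/s)\<^sup>2))" for y
        unfolding norm_of_real abs_of_nonneg[OF k_nonneg]
        using s by (auto simp: k_def normal_density_def intro!: divide_right_mono)
    qed
    from integral_norm_bound_ennreal[OF this] show ?thesis
      by (simp add: Fv norm_mult)
  qed
  let ?N = "\<integral>\<^sup>+x. ennreal ((norm (u x))\<^sup>2) \<partial>lebesgue"
  have half: "(\<integral>\<^sup>+x. \<integral>\<^sup>+y. ennreal ((norm (u x))\<^sup>2 / 2 * k x y) \<partial>lebesgue \<partial>lebesgue) = ennreal pi * ?N"
  proof -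
    have "(\<integral>\<^sup>+x. \<integral>\<^sup>+y. ennreal ((norm (u x))\<^sup>2 / 2 * k x y) \<partial>lebesgue \<partial>lebesgue)
       = (\<integral>\<^sup>+x. ennreal ((norm (u x))\<^sup>2 / 2) * ennreal (2 * pi) \<partial>lebesgue)"
    proof (intro nn_integral_cong)
      fix x
      have "(\<integral>\<^sup>+y. ennreal ((norm (u x))\<^sup>2 / 2 * k x y) \<partial>lebesgue)
         = (\<integral>\<^sup>+y. ennreal ((norm (u x))\<^sup>2 / 2) * ennreal (k x y) \<partial>lebesgue)"
        by (intro nn_integral_cong ennreal_mult) simp_all
      also have "\<dots> = ennreal ((norm (u x))\<^sup>2 / 2) * ennreal (2 * pi)"
        by (subst nn_integral_cmult) (measurable, simp only: k_int)
      finally show "(\<integral>\<^sup>+y. ennreal ((norm (u x))\<^sup>2 / 2 * k x y) \<partial>lebesgue)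
         = ennreal ((norm (u x))\<^sup>2 / 2) * ennreal (2 * pi)" .
    qed
    also have "\<dots> = (\<integral>\<^sup>+x. ennreal pi * ennreal ((norm (u x))\<^sup>2) \<partial>lebesgue)"
      by (intro nn_integral_cong) (simp add: ennreal_mult[symmetric] mult_ac)
    finally show ?thesis by (simp add: nn_integral_cmult)
  qed
  have uv: "fourier_integral u w * v w =
      complex_of_real (exp (- (w / s)\<^sup>2 / 2) * (norm (fourier_integral u w))\<^sup>2)" for w
    unfolding v_def W of_real_mult complex_norm_square by (simp only: mult_ac)
  have "integrable lebesgue (\<lambda>w. fourier_integral u w * v w)"
  proof -
    have "integrable lebesgue (\<lambda>w. v w * fourier_integral u w)"
      by (rule integrable_L1_mult_bounded[OF v1]) (use norm_fourier_integral_le[OF u1] in auto)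
    then show ?thesis by (simp add: mult.commute)
  qed
  then have int: "integrable lebesgue (\<lambda>w. complex_of_real (exp (- (w / s)\<^sup>2 / 2) * (norm (fourier_integral u w))\<^sup>2))"
    unfolding uv .
  then have int': "integrable lebesgue (\<lambda>w. exp (- (w / s)\<^sup>2 / 2) * (norm (fourier_integral u w))\<^sup>2)"
    by (simp only: complex_of_real_integrable_eq)
  have "(\<integral>\<^sup>+w. ennreal (exp (- (w / s)\<^sup>2 / 2) * (norm (fourier_integral u w))\<^sup>2) \<partial>lebesgue) =
      ennreal (LINT w|lebesgue. exp (- (w / s)\<^sup>2 / 2) * (norm (fourier_integral u w))\<^sup>2)"
    by (rule nn_integral_eq_integral[OF int']) simp
  also have "\<dots> = ennreal (norm (complex_of_real (LINT w|lebesgue. exp (- (w / s)\<^sup>2 / 2) * (norm (fourier_integral u w))\<^sup>2)))"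
    by (simp add: integral_nonneg_AE)
  also have "\<dots> = ennreal (norm (LINT w|lebesgue. fourier_integral u w * v w))"
    unfolding uv Bochner_Integration.integral_complex_of_real ..
  also have "\<dots> = ennreal (norm (LINT x|lebesgue. u x * fourier_integral v x))"
    by (simp only: fourier_duality[OF u1 v1])
  also have "\<dots> \<le> (\<integral>\<^sup>+x. norm (u x * fourier_integral v x) \<partial>lebesgue)"
    by (rule integral_norm_bound_ennreal, rule integrable_L1_mult_bounded[OF u1 fourier_integral_measurable[OF v1]
      norm_fourier_integral_le[OF v1]])
  also have "\<dots> \<le> (\<integral>\<^sup>+x. \<integral>\<^sup>+y. ennreal (norm (u x) * norm (u y) * k x y) \<partial>lebesgue \<partial>lebesgue)"
  proof (rule nn_integral_mono)
    fix x
    have "ennreal (norm (u x * fourier_integral v x)) \<le>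
        ennreal (norm (u x)) * (\<integral>\<^sup>+y. ennreal (norm (u y) * k x y) \<partial>lebesgue)"
      unfolding norm_mult by (subst ennreal_mult) (auto intro!: mult_left_mono nFv)
    also have "\<dots> = (\<integral>\<^sup>+y. ennreal (norm (u x) * norm (u y) * k x y) \<partial>lebesgue)"
      by (subst nn_integral_cmult[symmetric], measurable, intro nn_integral_cong,
          subst ennreal_mult[symmetric]) (simp_all add: mult.assoc)
    finally show "ennreal (norm (u x * fourier_integral v x)) \<le>
      (\<integral>\<^sup>+y. ennreal (norm (u x) * norm (u y) * k x y) \<partial>lebesgue)" .
  qed
  also have "\<dots> \<le> (\<integral>\<^sup>+x. \<integral>\<^sup>+y. ennreal ((norm (u x))\<^sup>2 / 2 * k x y) + ennreal ((norm (u y))\<^sup>2 / 2 * k x y) \<partial>lebesgue \<partial>lebesgue)"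
  proof (intro nn_integral_mono)
    fix x y
    have "norm (u x) * norm (u y) \<le> (norm (u x))\<^sup>2 / 2 + (norm (u y))\<^sup>2 / 2"
      using sum_squares_bound[of "norm (u x)" "norm (u y)"] by simp
    from mult_right_mono[OF this k_nonneg[of x y]]
    show "ennreal (norm (u x) * norm (u y) * k x y) \<le>
        ennreal ((norm (u x))\<^sup>2 / 2 * k x y) + ennreal ((norm (u y))\<^sup>2 / 2 * k x y)"
      by (subst ennreal_plus[symmetric]) (auto simp only: distrib_right intro!: ennreal_leI mult_nonneg_nonneg k_nonneg zero_le_power2 divide_nonneg_pos zero_less_numeral)
  qed
  also have "\<dots> = (\<integral>\<^sup>+x. \<integral>\<^sup>+y. ennreal ((norm (u x))\<^sup>2 / 2 * k x y) \<partial>lebesgue \<partial>lebesgue)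
      + (\<integral>\<^sup>+x. \<integral>\<^sup>+y. ennreal ((norm (u y))\<^sup>2 / 2 * k x y) \<partial>lebesgue \<partial>lebesgue)"
    by (simp add: nn_integral_add)
  also have "(\<integral>\<^sup>+x. \<integral>\<^sup>+y. ennreal ((norm (u y))\<^sup>2 / 2 * k x y) \<partial>lebesgue \<partial>lebesgue)
      = (\<integral>\<^sup>+y. \<integral>\<^sup>+x. ennreal ((norm (u y))\<^sup>2 / 2 * k y x) \<partial>lebesgue \<partial>lebesgue)"
  proof -
    have "(\<lambda>(x, y). ennreal ((norm (u y))\<^sup>2 / 2 * k x y)) \<in> borel_measurable (lebesgue \<Otimes>\<^sub>M lebesgue)"
      by measurable
    from lebesgue_pair.Fubini'[OF this]
    have "(\<integral>\<^sup>+x. \<integral>\<^sup>+y. ennreal ((norm (u y))\<^sup>2 / 2 * k x y) \<partial>lebesgue \<partial>lebesgue) =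
       (\<integral>\<^sup>+y. \<integral>\<^sup>+x. ennreal ((norm (u y))\<^sup>2 / 2 * k x y) \<partial>lebesgue \<partial>lebesgue)"
      by (rule sym)
    also have "\<dots> = (\<integral>\<^sup>+y. \<integral>\<^sup>+x. ennreal ((norm (u y))\<^sup>2 / 2 * k y x) \<partial>lebesgue \<partial>lebesgue)"
      by (intro nn_integral_cong, subst k_sym, rule refl)
    finally show ?thesis .
  qed
  also have "(\<integral>\<^sup>+x. \<integral>\<^sup>+y. ennreal ((norm (u x))\<^sup>2 / 2 * k x y) \<partial>lebesgue \<partial>lebesgue) +
      (\<integral>\<^sup>+y. \<integral>\<^sup>+x. ennreal ((norm (u y))\<^sup>2 / 2 * k y x) \<partial>lebesgue \<partial>lebesgue) = ennreal (2 * pi) * ?N"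
  proof -
    have "ennreal (2 * pi) = ennreal pi + ennreal pi"
      by (subst ennreal_plus[symmetric]) simp_all
    then show ?thesis
      unfolding half by (simp only: distrib_right)
  qed
  finally show ?thesis .
qed

text \<open>
  As the width of the Gaussian weight grows, the weight tends to \<open>1\<close>, and Fatou's lemma removes it.
\<close>
lemma plancherel_le:
  assumes u1: "u \<in> L1"
  shows "(\<integral>\<^sup>+w. ennreal ((norm (fourier_integral u w))\<^sup>2) \<partial>lebesgue)
    \<le> ennreal (2 * pi) * (\<integral>\<^sup>+x. ennreal ((norm (u x))\<^sup>2) \<partial>lebesgue)" (is "_ \<le> ?C")
proof -
  let ?g = "\<lambda>n w. ennreal (exp (- (w / real (Suc n))\<^sup>2 / 2) * (norm (fourier_integral u w))\<^sup>2)"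
  have [measurable]: "fourier_integral u \<in> borel_measurable lebesgue"
    using u1 by (rule fourier_integral_measurable)
  have e: "(\<lambda>w. exp (- (w / real (Suc n))\<^sup>2 / 2)) \<in> borel_measurable lebesgue" for n
    by (intro borel_imp_lebesgue_measurable borel_measurable_continuous_onI continuous_intros) simp_all
  have lim: "(\<lambda>n. ?g n w) \<longlonglongrightarrow> ennreal ((norm (fourier_integral u w))\<^sup>2)" for w
  proof -
    let ?h = "\<lambda>t. exp (- t\<^sup>2 / 2) * (norm (fourier_integral u w))\<^sup>2"
    have l: "(\<lambda>n. w / real (Suc n)) \<longlonglongrightarrow> 0"
      by (rule LIMSEQ_Suc[OF lim_const_over_n])
    have "isCont ?h 0"
      by (intro continuous_intros) auto
    from isCont_tendsto_compose[OF this l]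
    have "(\<lambda>n. ennreal (?h (w / real (Suc n)))) \<longlonglongrightarrow> ennreal (?h 0)"
      by (rule tendsto_ennrealI)
    moreover have "?h 0 = (norm (fourier_integral u w))\<^sup>2" by simp
    ultimately show ?thesis by (simp only:)
  qed
  have "(\<integral>\<^sup>+w. ennreal ((norm (fourier_integral u w))\<^sup>2) \<partial>lebesgue)
      = (\<integral>\<^sup>+w. liminf (\<lambda>n. ?g n w) \<partial>lebesgue)"
  proof (rule nn_integral_cong)
    show "ennreal ((norm (fourier_integral u w))\<^sup>2) = liminf (\<lambda>n. ?g n w)" for w
      using lim_imp_Liminf[OF sequentially_bot lim[of w]] by (rule sym)
  qed
  also have "\<dots> \<le> liminf (\<lambda>n. \<integral>\<^sup>+w. ?g n w \<partial>lebesgue)"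
    by (intro nn_integral_liminf measurable_compose[OF _ measurable_ennreal] borel_measurable_times e) measurable
  also have "\<dots> \<le> limsup (\<lambda>n. \<integral>\<^sup>+w. ?g n w \<partial>lebesgue)"
    by (rule Liminf_le_Limsup) simp
  also have "\<dots> \<le> ?C"
  proof (rule Limsup_bounded, rule always_eventually, rule allI)
    show "(\<integral>\<^sup>+w. ?g n w \<partial>lebesgue) \<le> ?C" for n
      by (rule weighted_plancherel_le[OF u1]) simp
  qed
  finally show ?thesis .
qed

section \<open>Uniqueness for integrable functions\<close>

lemma fourier_integral_cong_AE:
  assumes "f \<in> borel_measurable lebesgue" "g \<in> borel_measurable lebesgue" "AE x in lebesgue. f x = g x"
  shows "fourier_integral f w = fourier_integral g w"
  unfolding fourier_integral_def using assms
  by (intro integral_cong_AE borel_measurable_times) (auto intro!: borel_imp_lebesgue_measurable)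

text \<open>
  The positive and negative parts of \<open>h\<close> have equal integrals \<open>c\<close> (frequency \<open>0\<close>). If \<open>c = 0\<close> both vanish;
  otherwise, divided by \<open>c\<close>, they are densities of two probability distributions with the same
  characteristic function, which coincide by Levy's theorem.
\<close>
lemma fourier_zero_imp_zero_borel:
  fixes h :: "real \<Rightarrow> real"
  assumes int: "integrable lborel h"
    and F0: "\<And>w. (LINT x|lborel. complex_of_real (h x) * exp (\<i> * complex_of_real (w * x))) = 0"
  shows "AE x in lborel. h x = 0"
proof -
  have [measurable]: "h \<in> borel_measurable borel" using int by auto
  define p where "p = (\<lambda>x. max 0 (h x))"
  define q where "q = (\<lambda>x. max 0 (- h x))"
  have [measurable]: "p \<in> borel_measurable borel" "q \<in> borel_measurable borel"
    by (auto simp: p_def q_def)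
  have pq: "h x = p x - q x" "0 \<le> p x" "0 \<le> q x" for x
    by (auto simp: p_def q_def)
  have ip: "integrable lborel p" and iq: "integrable lborel q"
    using int by (auto simp: p_def q_def)
  have ie: "integrable lborel (\<lambda>x. complex_of_real (f x) * exp (\<i> * complex_of_real (w * x)))"
    if "integrable lborel f" for f :: "real \<Rightarrow> real" and w
  proof (rule Bochner_Integration.integrable_bound[OF that])
    show "(\<lambda>x. complex_of_real (f x) * exp (\<i> * complex_of_real (w * x))) \<in> borel_measurable lborel"
      using that by measurable
  qed (simp add: norm_mult)
  have eq: "(LINT x|lborel. complex_of_real (p x) * exp (\<i> * complex_of_real (w * x))) =
        (LINT x|lborel. complex_of_real (q x) * exp (\<i> * complex_of_real (w * x)))" for w
    using F0[of w] ie[OF ip] ie[OF iq] by (simp add: pq left_diff_distrib)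
  define c where "c = (LINT x|lborel. p x)"
  have c': "c = (LINT x|lborel. q x)"
    using eq[of 0] by (simp add: c_def)
  show ?thesis
  proof (cases "c = 0")
    case True
    have "AE x in lborel. p x = 0" "AE x in lborel. q x = 0"
      using True c' integral_nonneg_eq_0_iff_AE[OF ip] integral_nonneg_eq_0_iff_AE[OF iq]
      by (auto simp: pq c_def)
    then show ?thesis by eventually_elim (simp add: pq)
  next
    case False
    have "c \<ge> 0" unfolding c_def by (intro integral_nonneg_AE) (simp add: pq)
    with False have c: "c > 0" by simp
    have rd: "real_distribution (density lborel (\<lambda>x. ennreal (f x / c)))"
      if [measurable]: "f \<in> borel_measurable borel" and f: "integrable lborel f" "\<And>x. 0 \<le> f x" "(LINT x|lborel. f x) = c" for f
    proof -
      have "(\<integral>\<^sup>+x. ennreal (f x / c) \<partial>lborel) = ennreal (LINT x|lborel. f x / c)"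
        using f c by (intro nn_integral_eq_integral) auto
      also have "\<dots> = 1" using f c by simp
      finally have "prob_space (density lborel (\<lambda>x. ennreal (f x / c)))"
        by (intro prob_spaceI) (simp add: emeasure_density)
      then show ?thesis
        by (simp add: real_distribution_def real_distribution_axioms_def)
    qed
    have ch: "char (density lborel (\<lambda>x. ennreal (f x / c))) w =
        (LINT x|lborel. complex_of_real (f x) * exp (\<i> * complex_of_real (w * x))) / c"
      if [measurable]: "f \<in> borel_measurable borel" and "\<And>x. 0 \<le> f x" for f w
    proof -
      have "char (density lborel (\<lambda>x. ennreal (f x / c))) w =
        (LINT x|lborel. (f x / c) *\<^sub>R exp (\<i> * complex_of_real (w * x)))"
        unfolding char_def using that c by (subst integral_density) auto
      also have "\<dots> = (LINT x|lborel. (complex_of_real (f x) * exp (\<i> * complex_of_real (w * x))) / c)"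
        by (intro Bochner_Integration.integral_cong refl) (simp add: scaleR_conv_of_real)
      finally show ?thesis by simp
    qed
    have "density lborel (\<lambda>x. ennreal (p x / c)) = density lborel (\<lambda>x. ennreal (q x / c))"
    proof (intro Levy_uniqueness rd ip iq ext)
      show "char (density lborel (\<lambda>x. ennreal (p x / c))) w = char (density lborel (\<lambda>x. ennreal (q x / c))) w" for w
        by (subst (1 2) ch) (simp_all only: pq eq, simp_all)
    qed (simp_all add: pq c_def[symmetric] c'[symmetric])
    then have "AE x in lborel. ennreal (p x / c) = ennreal (q x / c)"
      by (rule sigma_finite_measure.density_unique[OF lborel.sigma_finite_measure_axioms, rotated 2]) auto
    then show ?thesis
      by eventually_elim (use c in \<open>simp add: pq\<close>)
  qed
qed

text \<open>
  The vanishing of the transform is inherited by the conjugate (with reflected frequency), hence by the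
  real and the imaginary part, which reduces the claim to real functions. Those are replaced by Borel
  measurable representatives, since Levy's theorem speaks of Borel measures.
\<close>
lemma L1_fourier_zero_imp_zero:
  assumes f: "f \<in> L1" and F0: "\<And>w. fourier_integral f w = 0"
  shows "AE x in lebesgue. f x = 0"
proof -
  have real_case: "AE x in lebesgue. h x = 0"
    if h: "integrable lebesgue h"
      and h0: "\<And>w. fourier_integral (\<lambda>x. complex_of_real (h x)) w = 0" for h :: "real \<Rightarrow> real"
  proof -
    have [measurable]: "h \<in> borel_measurable lebesgue" using h by auto
    obtain h' where h'[measurable]: "h' \<in> borel_measurable lborel" and ae: "AE x in lborel. h x = h' x"
      using completion_ex_borel_measurable_real[of h lborel] by auto
    have ae': "AE x in lebesgue. h x = h' x" using ae by (rule AE_completion)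
    have h'l [measurable]: "h' \<in> borel_measurable lebesgue"
      using h' by (rule measurable_completion)
    have "integrable lebesgue h'"
      using h by (subst integrable_cong_AE[of h' _ h]) (use ae' in \<open>auto\<close>)
    then have i: "integrable lborel h'"
      using h' by (simp add: integrable_completion)
    have "AE x in lborel. h' x = 0"
    proof (rule fourier_zero_imp_zero_borel[OF i])
      fix w
      have "(LINT x|lborel. complex_of_real (h' x) * exp (\<i> * complex_of_real (w * x))) =
         (LINT x|lebesgue. complex_of_real (h' x) * exp (\<i> * complex_of_real (w * x)))"
        by (rule integral_completion[symmetric]) (use h' in simp)
      also have "\<dots> = fourier_integral (\<lambda>x. complex_of_real (h' x)) (- w)"
        unfolding fourier_integral_def by (simp add: mult_ac)
      also have "\<dots> = fourier_integral (\<lambda>x. complex_of_real (h x)) (- w)"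
        by (rule fourier_integral_cong_AE) (use ae' in \<open>auto\<close>)
      finally show "(LINT x|lborel. complex_of_real (h' x) * exp (\<i> * complex_of_real (w * x))) = 0"
        by (simp add: h0)
    qed
    from AE_completion[OF this] ae' show ?thesis by eventually_elim simp
  qed
  have fi: "integrable lebesgue f" using f by (simp add: L1_def)
  have kint: "integrable lebesgue (\<lambda>x. f x * exp (- \<i> * complex_of_real w * complex_of_real x))" for w
    by (rule integrable_fourier[OF f])
  have cF: "(LINT x|lebesgue. cnj (f x) * exp (- \<i> * complex_of_real w * complex_of_real x)) = 0" for w
  proof -
    have "(LINT x|lebesgue. cnj (f x) * exp (- \<i> * complex_of_real w * complex_of_real x)) =
       (LINT x|lebesgue. cnj (f x * exp (- \<i> * complex_of_real (- w) * complex_of_real x)))"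
      by (intro Bochner_Integration.integral_cong refl) (simp add: exp_cnj)
    also have "\<dots> = cnj (fourier_integral f (- w))"
      unfolding fourier_integral_def by (rule Bochner_Integration.integral_cnj)
    finally show ?thesis by (simp add: F0)
  qed
  have ckint: "integrable lebesgue (\<lambda>x. cnj (f x) * exp (- \<i> * complex_of_real w * complex_of_real x))" for w
    using integrable_fourier[of "\<lambda>x. cnj (f x)" w] fi by (simp add: L1_def)
  have F0': "(LINT x|lebesgue. f x * exp (- \<i> * complex_of_real w * complex_of_real x)) = 0" for w
    using F0[of w] by (simp add: fourier_integral_def)
  have "AE x in lebesgue. Re (f x) = 0"
  proof (rule real_case)
    show "integrable lebesgue (\<lambda>x. Re (f x))" using fi by simp
    fix w
    have "fourier_integral (\<lambda>x. complex_of_real (Re (f x))) w =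
      (LINT x|lebesgue. (f x * exp (- \<i> * complex_of_real w * complex_of_real x)
         + cnj (f x) * exp (- \<i> * complex_of_real w * complex_of_real x)) * (1/2))"
      unfolding fourier_integral_def
      by (intro Bochner_Integration.integral_cong refl)
         (simp add: distrib_right[symmetric] complex_add_cnj)
    also have "\<dots> = 0"
      by (subst integral_mult_left_zero) (simp only: Bochner_Integration.integral_add[OF kint ckint] F0' cF, simp)
    finally show "fourier_integral (\<lambda>x. complex_of_real (Re (f x))) w = 0" .
  qed
  moreover have "AE x in lebesgue. Im (f x) = 0"
  proof (rule real_case)
    show "integrable lebesgue (\<lambda>x. Im (f x))" using fi by simp
    fix w
    have "fourier_integral (\<lambda>x. complex_of_real (Im (f x))) w =
      (LINT x|lebesgue. (f x * exp (- \<i> * complex_of_real w * complex_of_real x)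
         - cnj (f x) * exp (- \<i> * complex_of_real w * complex_of_real x)) * (1/(2 * \<i>)))"
      unfolding fourier_integral_def
      by (intro Bochner_Integration.integral_cong refl)
         (simp add: left_diff_distrib[symmetric] complex_diff_cnj field_simps)
    also have "\<dots> = 0"
      by (subst integral_mult_left_zero) (simp only: Bochner_Integration.integral_diff[OF kint ckint] F0' cF, simp)
    finally show "fourier_integral (\<lambda>x. complex_of_real (Im (f x))) w = 0" .
  qed
  ultimately show ?thesis by eventually_elim (simp add: complex_eq_iff)
qed

section \<open>Completeness of square integrable functions\<close>

text \<open>
  The Riesz--Fischer theorem for sequences with geometric decay. The series
  \<open>\<Sum> 2\<^sup>k |u\<^bsub>k+1\<^esub> - u\<^bsub>k\<^esub>|\<^sup>2\<close> has a finite integral, so it converges almost everywhere; since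
  \<open>2 d \<le> 2\<^sup>-\<^sup>k + 2\<^sup>k d\<^sup>2\<close>, the increments are then absolutely summable. Fatou's lemma transfers the Cauchy
  bounds to the pointwise limit.
\<close>
lemma L2_complete_geometric:
  fixes u :: "nat \<Rightarrow> 'a \<Rightarrow> complex"
  assumes [measurable]: "\<And>n. u n \<in> borel_measurable M"
    and C: "C < \<infinity>"
    and cau: "\<And>k m. k \<le> m \<Longrightarrow> (\<integral>\<^sup>+x. ennreal ((norm (u m x - u k x))\<^sup>2) \<partial>M) \<le> C * ennreal ((1/4) ^ k)"
  shows "\<exists>g \<in> borel_measurable M. \<forall>k. (\<integral>\<^sup>+x. ennreal ((norm (u k x - g x))\<^sup>2) \<partial>M) \<le> C * ennreal ((1/4) ^ k)"
proof -
  define S where "S x = (\<Sum>k. ennreal (2 ^ k * (norm (u (Suc k) x - u k x))\<^sup>2))" for x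
  have "(\<integral>\<^sup>+x. S x \<partial>M) = (\<Sum>k. \<integral>\<^sup>+x. ennreal (2 ^ k * (norm (u (Suc k) x - u k x))\<^sup>2) \<partial>M)"
    unfolding S_def by (rule nn_integral_suminf) simp
  also have "\<dots> \<le> (\<Sum>k. C * ennreal ((1/2) ^ k))"
  proof (intro suminf_le allI summableI)
    fix k
    have "(\<integral>\<^sup>+x. ennreal (2 ^ k * (norm (u (Suc k) x - u k x))\<^sup>2) \<partial>M)
       = ennreal (2 ^ k) * (\<integral>\<^sup>+x. ennreal ((norm (u (Suc k) x - u k x))\<^sup>2) \<partial>M)"
      by (simp add: ennreal_mult nn_integral_cmult)
    also have "\<dots> \<le> ennreal (2 ^ k) * (C * ennreal ((1/4) ^ k))"
      by (intro mult_left_mono cau) auto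
    also have "\<dots> = C * ennreal (2 ^ k * (1/4) ^ k)"
      by (simp only: ennreal_mult zero_le_power zero_le_numeral mult_ac zero_le_divide_1_iff)
    also have "(2::real) ^ k * (1/4) ^ k = (1/2) ^ k"
      by (simp add: power_mult_distrib[symmetric])
    finally show "(\<integral>\<^sup>+x. ennreal (2 ^ k * (norm (u (Suc k) x - u k x))\<^sup>2) \<partial>M) \<le> C * ennreal ((1/2) ^ k)" .
  qed
  also have "\<dots> = C * ennreal (\<Sum>k. (1/2) ^ k)"
    by (subst suminf_ennreal2[symmetric]) (auto simp: summable_geometric)
  also have "\<dots> < \<infinity>" using C by (simp add: ennreal_mult_less_top)
  finally have "(\<integral>\<^sup>+x. S x \<partial>M) \<noteq> \<infinity>" by simp
  then have ae: "AE x in M. S x \<noteq> \<infinity>"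
    by (intro nn_integral_PInf_AE) (auto simp: S_def)
  have conv: "convergent (\<lambda>n. u n x)" if "S x \<noteq> \<infinity>" for x
  proof -
    let ?d = "\<lambda>k. norm (u (Suc k) x - u k x)"
    have s: "summable (\<lambda>k. 2 ^ k * (?d k)\<^sup>2)"
      using that unfolding S_def by (intro summable_suminf_not_top) auto
    have "summable (\<lambda>k. ((1/2) ^ k + 2 ^ k * (?d k)\<^sup>2) / 2)"
      by (intro summable_divide summable_add s) (simp add: summable_geometric)
    moreover have "norm (u (Suc k) x - u k x) \<le> ((1/2) ^ k + 2 ^ k * (?d k)\<^sup>2) / 2" for k
    proof -
      \<comment> \<open>Arithmetic and geometric mean of \<open>1\<close> and \<open>2 ^ k * ?d k\<close>, divided by \<open>2 ^ k\<close>.\<close>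
      have "0 \<le> (1 - 2 ^ k * ?d k)\<^sup>2" by simp
      then have "2 * (2 ^ k * ?d k) \<le> 1 + 2 ^ k * (2 ^ k * (?d k)\<^sup>2)"
        by (simp add: power2_eq_square algebra_simps)
      then show ?thesis by (simp add: power_divide field_simps)
    qed
    ultimately have "summable (\<lambda>k. u (Suc k) x - u k x)"
      by (rule summable_comparison_test'[where N=0])
    then have "convergent (\<lambda>n. \<Sum>k<n. u (Suc k) x - u k x)"
      by (simp add: summable_iff_convergent)
    then have "convergent (\<lambda>n. u n x - u 0 x)"
      by (simp only: sum_lessThan_telescope[of "\<lambda>k. u k x"])
    then have "convergent (\<lambda>n. (u n x - u 0 x) + u 0 x)"
      by (intro convergent_add convergent_const)
    then show ?thesis by simp
  qed
  define g where "g x = lim (\<lambda>n. u n x)" for x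
  have [measurable]: "g \<in> borel_measurable M"
    unfolding g_def by (intro borel_measurable_lim_metric) simp
  have lim: "AE x in M. (\<lambda>n. u n x) \<longlonglongrightarrow> g x"
    using ae by eventually_elim (simp add: conv g_def convergent_LIMSEQ_iff[symmetric])
  have "(\<integral>\<^sup>+x. ennreal ((norm (u k x - g x))\<^sup>2) \<partial>M) \<le> C * ennreal ((1/4) ^ k)" for k
  proof -
    have "(\<integral>\<^sup>+x. ennreal ((norm (u k x - g x))\<^sup>2) \<partial>M) =
       (\<integral>\<^sup>+x. liminf (\<lambda>m. ennreal ((norm (u m x - u k x))\<^sup>2)) \<partial>M)"
    proof (intro nn_integral_cong_AE, use lim in eventually_elim)
      fix x assume "(\<lambda>n. u n x) \<longlonglongrightarrow> g x"
      then have "(\<lambda>m. ennreal ((norm (u m x - u k x))\<^sup>2)) \<longlonglongrightarrow> ennreal ((norm (g x - u k x))\<^sup>2)"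
        by (intro tendsto_intros)
      from lim_imp_Liminf[OF _ this]
      show "ennreal ((norm (u k x - g x))\<^sup>2) = liminf (\<lambda>m. ennreal ((norm (u m x - u k x))\<^sup>2))"
        by (simp add: norm_minus_commute)
    qed
    also have "\<dots> \<le> liminf (\<lambda>m. \<integral>\<^sup>+x. ennreal ((norm (u m x - u k x))\<^sup>2) \<partial>M)"
      by (rule nn_integral_liminf) simp
    also have "\<dots> \<le> limsup (\<lambda>m. \<integral>\<^sup>+x. ennreal ((norm (u m x - u k x))\<^sup>2) \<partial>M)"
      by (rule Liminf_le_Limsup) simp
    also have "\<dots> \<le> C * ennreal ((1/4) ^ k)"
      by (rule Limsup_bounded) (use cau in \<open>auto simp: eventually_sequentially\<close>)
    finally show ?thesis .
  qed
  then show ?thesis by (intro bexI[of _ g]) auto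
qed

section \<open>Square integrable functions and duality\<close>

lemma L2_mult_integrable:
  assumes f: "f \<in> L2" and g: "g \<in> L2"
  shows "integrable lebesgue (\<lambda>x. f x * g x)"
proof (rule Bochner_Integration.integrable_bound)
  have [measurable]: "f \<in> borel_measurable lebesgue" "g \<in> borel_measurable lebesgue"
    using f g by (auto intro: L2_measurable)
  show "integrable lebesgue (\<lambda>x. (norm (f x))\<^sup>2 + (norm (g x))\<^sup>2)"
    using f g by (auto simp: L2_def)
  show "(\<lambda>x. f x * g x) \<in> borel_measurable lebesgue" by measurable
  have "norm (f x * g x) \<le> norm ((norm (f x))\<^sup>2 + (norm (g x))\<^sup>2)" for x
  proof -
    have "0 \<le> norm (f x) * norm (g x)" by simp
    with sum_squares_bound[of "norm (f x)" "norm (g x)"] show ?thesis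
      unfolding norm_mult real_norm_def by linarith
  qed
  then show "AE x in lebesgue. norm (f x * g x) \<le> norm ((norm (f x))\<^sup>2 + (norm (g x))\<^sup>2)" by simp
qed

lemma L2_iff_nn_integral:
  "f \<in> L2 \<longleftrightarrow> f \<in> borel_measurable lebesgue \<and> (\<integral>\<^sup>+x. ennreal ((norm (f x))\<^sup>2) \<partial>lebesgue) < \<infinity>"
  unfolding L2_def by (auto simp: integrable_iff_bounded)

lemma L2_add:
  assumes f: "f \<in> L2" and g: "g \<in> L2"
  shows "(\<lambda>x. f x + g x) \<in> L2"
  unfolding L2_def mem_Collect_eq
proof
  have [measurable]: "f \<in> borel_measurable lebesgue" "g \<in> borel_measurable lebesgue"
    using f g by (auto intro: L2_measurable)
  show "(\<lambda>x. f x + g x) \<in> borel_measurable lebesgue" by measurable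
  show "integrable lebesgue (\<lambda>x. (norm (f x + g x))\<^sup>2)"
  proof (rule Bochner_Integration.integrable_bound)
    show "integrable lebesgue (\<lambda>x. 2 * (norm (f x))\<^sup>2 + 2 * (norm (g x))\<^sup>2)"
      using f g by (auto simp: L2_def)
    show "(\<lambda>x. (norm (f x + g x))\<^sup>2) \<in> borel_measurable lebesgue" by measurable
    have "norm ((norm (f x + g x))\<^sup>2) \<le> norm (2 * (norm (f x))\<^sup>2 + 2 * (norm (g x))\<^sup>2)" for x
    proof -
      have "(norm (f x + g x))\<^sup>2 \<le> (norm (f x) + norm (g x))\<^sup>2"
        by (intro power_mono norm_triangle_ineq) simp
      also have "\<dots> \<le> 2 * (norm (f x))\<^sup>2 + 2 * (norm (g x))\<^sup>2"
        using sum_squares_bound[of "norm (f x)" "norm (g x)"] by (simp add: power2_sum)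
      finally show ?thesis by simp
    qed
    then show "AE x in lebesgue. norm ((norm (f x + g x))\<^sup>2) \<le> norm (2 * (norm (f x))\<^sup>2 + 2 * (norm (g x))\<^sup>2)"
      by simp
  qed
qed

lemma L2_cmult: "f \<in> L2 \<Longrightarrow> (\<lambda>x. c * f x) \<in> L2"
  unfolding L2_def mem_Collect_eq norm_mult power_mult_distrib
  by (intro conjI borel_measurable_times borel_measurable_const integrable_mult_right) blast+

lemma L2_diff: "f \<in> L2 \<Longrightarrow> g \<in> L2 \<Longrightarrow> (\<lambda>x. f x - g x) \<in> L2"
  using L2_add[of f "\<lambda>x. (-1) * g x"] L2_cmult[of g "-1"] by simp

lemma L2_cnj: "f \<in> L2 \<Longrightarrow> (\<lambda>x. cnj (f x)) \<in> L2"
  by (auto simp: L2_def intro: borel_measurable_cnj)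

lemma L2_norm_le:
  assumes f: "f \<in> L2" and g: "g \<in> borel_measurable lebesgue" and le: "\<And>x. norm (g x) \<le> norm (f x)"
  shows "g \<in> L2"
proof -
  have "(\<integral>\<^sup>+x. ennreal ((norm (g x))\<^sup>2) \<partial>lebesgue) \<le> (\<integral>\<^sup>+x. ennreal ((norm (f x))\<^sup>2) \<partial>lebesgue)"
    by (intro nn_integral_mono ennreal_leI power_mono le) simp
  then show ?thesis using f g by (auto simp: L2_iff_nn_integral intro: le_less_trans)
qed

lemma L2_tendsto_imp_integral_tendsto:
  assumes u: "\<And>n. u n \<in> L2" and f: "f \<in> L2" and p: "p \<in> L2" and lim: "L2_tendsto u f"
  shows "(\<lambda>n. LINT x|lebesgue. u n x * p x) \<longlonglongrightarrow> (LINT x|lebesgue. f x * p x)"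
proof -
  have [measurable]: "f \<in> borel_measurable lebesgue" "p \<in> borel_measurable lebesgue"
      "u n \<in> borel_measurable lebesgue" for n
    using f p u by (auto intro: L2_measurable)
  let ?A = "\<lambda>n. \<integral>\<^sup>+x. ennreal ((norm (u n x - f x))\<^sup>2) \<partial>lebesgue"
  let ?B = "\<integral>\<^sup>+x. ennreal ((norm (p x))\<^sup>2) \<partial>lebesgue"
  define d where "d n = (LINT x|lebesgue. u n x * p x) - (LINT x|lebesgue. f x * p x)" for n
  have d: "ennreal ((norm (d n))\<^sup>2) \<le> ?A n * ?B" for n
  proof -
    have "d n = (LINT x|lebesgue. (u n x - f x) * p x)"
      unfolding d_def left_diff_distrib
      by (rule Bochner_Integration.integral_diff[symmetric]) (intro L2_mult_integrable u f p)+
    then have "ennreal (norm (d n)) \<le> (\<integral>\<^sup>+x. norm ((u n x - f x) * p x) \<partial>lebesgue)"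
      by (simp only:) (intro integral_norm_bound_ennreal L2_mult_integrable L2_diff u f p)
    also have "\<dots> = (\<integral>\<^sup>+x. ennreal (norm (u n x - f x)) * ennreal (norm (p x)) \<partial>lebesgue)"
      by (intro nn_integral_cong) (simp add: norm_mult ennreal_mult)
    finally have "(ennreal (norm (d n)))\<^sup>2 \<le>
        (\<integral>\<^sup>+x. ennreal (norm (u n x - f x)) * ennreal (norm (p x)) \<partial>lebesgue)\<^sup>2"
      by (rule power_mono) simp
    also have "\<dots> \<le> (\<integral>\<^sup>+x. (ennreal (norm (u n x - f x)))\<^sup>2 \<partial>lebesgue) * (\<integral>\<^sup>+x. (ennreal (norm (p x)))\<^sup>2 \<partial>lebesgue)"
      by (rule Cauchy_Schwarz_nn_integral) measurable
    finally show ?thesis by (simp only: ennreal_power norm_ge_zero)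
  qed
  have B: "?B \<noteq> top"
    using p by (simp add: L2_iff_nn_integral less_top)
  have "?A \<longlonglongrightarrow> 0" using lim unfolding L2_tendsto_def .
  from tendsto_mult_ennreal[OF this tendsto_const[of ?B]] B
  have "(\<lambda>n. ?A n * ?B) \<longlonglongrightarrow> 0" by simp
  from tendsto_sandwich[OF _ _ tendsto_const this, of "\<lambda>n. ennreal ((norm (d n))\<^sup>2)"] d
  have "(\<lambda>n. ennreal ((norm (d n))\<^sup>2)) \<longlonglongrightarrow> ennreal 0" by simp
  then have "(\<lambda>n. (norm (d n))\<^sup>2) \<longlonglongrightarrow> 0"
    by (rule tendsto_ennrealD) simp_all
  then have "(\<lambda>n. sqrt ((norm (d n))\<^sup>2)) \<longlonglongrightarrow> sqrt 0" by (rule tendsto_real_sqrt)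
  then have "d \<longlonglongrightarrow> 0" by (simp add: tendsto_norm_zero_iff)
  then show ?thesis unfolding d_def by (rule LIM_zero_cancel)
qed

lemma fourier_integral_L2:
  assumes "u \<in> L1 \<inter> L2"
  shows "fourier_integral u \<in> L2"
proof -
  have "(\<integral>\<^sup>+w. ennreal ((norm (fourier_integral u w))\<^sup>2) \<partial>lebesgue)
      \<le> ennreal (2 * pi) * (\<integral>\<^sup>+x. ennreal ((norm (u x))\<^sup>2) \<partial>lebesgue)"
    using assms by (intro plancherel_le) simp
  also have "\<dots> < \<infinity>"
  proof -
    have "(\<integral>\<^sup>+x. ennreal ((norm (u x))\<^sup>2) \<partial>lebesgue) < top"
      using assms by (simp add: L2_iff_nn_integral)
    with ennreal_less_top[of "2 * pi"] show ?thesis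
      unfolding infinity_ennreal_def by (simp only: ennreal_mult_less_top) simp
  qed
  finally show ?thesis
    using assms by (simp add: L2_iff_nn_integral fourier_integral_measurable)
qed

text \<open>
  Approximate \<open>f\<close> by the functions \<open>u n\<close> of the definition. The test function and its transform are both
  square integrable, so both sides pass to the limit.
\<close>
lemma is_fourier_transform_duality:
  assumes fg: "is_fourier_transform f g" and p: "p \<in> L1 \<inter> L2"
  shows "(LINT w|lebesgue. g w * p w) = (LINT x|lebesgue. f x * fourier_integral p x)"
proof -
  obtain u where u: "\<And>n. u n \<in> L1 \<inter> L2" "L2_tendsto u f" "L2_tendsto (\<lambda>n. fourier_integral (u n)) g"
    and f: "f \<in> L2" and g: "g \<in> L2"
    using fg unfolding is_fourier_transform_def by blast
  have "(\<lambda>n. LINT w|lebesgue. fourier_integral (u n) w * p w) \<longlonglongrightarrow> (LINT w|lebesgue. g w * p w)"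
    using u g p by (intro L2_tendsto_imp_integral_tendsto fourier_integral_L2) auto
  moreover have "(\<lambda>n. LINT x|lebesgue. u n x * fourier_integral p x) \<longlonglongrightarrow> (LINT x|lebesgue. f x * fourier_integral p x)"
    using u f p by (intro L2_tendsto_imp_integral_tendsto fourier_integral_L2) auto
  moreover have "(LINT w|lebesgue. fourier_integral (u n) w * p w) = (LINT x|lebesgue. u n x * fourier_integral p x)" for n
    using u(1)[of n] p by (intro fourier_duality) auto
  ultimately show ?thesis by (simp only: LIMSEQ_unique)
qed

lemma wave_packet_lebesgue_measurable: "wave_packet b s a \<in> borel_measurable lebesgue"
  by (rule borel_imp_lebesgue_measurable) measurable

lemma L2_mult_wave_packet:
  assumes f: "f \<in> L2" and s: "s > 0"
  shows "(\<lambda>x. f x * wave_packet b s a x) \<in> L1 \<inter> L2"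
proof
  show "(\<lambda>x. f x * wave_packet b s a x) \<in> L1"
    unfolding L1_def using L2_mult_integrable[OF f wave_packet_L2[OF s]] by simp
  show "(\<lambda>x. f x * wave_packet b s a x) \<in> L2"
  proof (rule L2_norm_le[OF f])
    show "(\<lambda>x. f x * wave_packet b s a x) \<in> borel_measurable lebesgue"
      using L2_measurable[OF f] wave_packet_lebesgue_measurable by (rule borel_measurable_times)
    show "norm (f x * wave_packet b s a x) \<le> norm (f x)" for x
      unfolding norm_mult by (rule mult_right_le_one_le) (auto simp: norm_wave_packet)
  qed
qed

text \<open>
  The difference \<open>d\<close> of two transforms is orthogonal to all of \<open>L\<^sup>1 \<inter> L\<^sup>2\<close>. The conjugate of \<open>d\<close> itself need
  not be integrable, but it is after multiplication by a Gaussian, and testing against this product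
  gives \<open>\<integral> |d|\<^sup>2 exp (- w\<^sup>2 / 2) = 0\<close>.
\<close>
lemma is_fourier_transform_unique:
  assumes "is_fourier_transform f g" "is_fourier_transform f g'"
  shows "AE w in lebesgue. g w = g' w"
proof -
  have g: "g \<in> L2" "g' \<in> L2" using assms by (auto simp: is_fourier_transform_def)
  define d where "d w = g w - g' w" for w
  have d: "d \<in> L2" unfolding d_def using g by (rule L2_diff)
  define p where "p w = cnj (d w) * wave_packet 0 1 0 w" for w
  have p: "p \<in> L1 \<inter> L2"
    unfolding p_def by (rule L2_mult_wave_packet) (auto intro: L2_cnj d)
  have "(LINT w|lebesgue. d w * p w) = (LINT w|lebesgue. g w * p w) - (LINT w|lebesgue. g' w * p w)"
    unfolding d_def left_diff_distrib
    by (rule Bochner_Integration.integral_diff) (use g p in \<open>auto intro: L2_mult_integrable\<close>)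
  also have "\<dots> = 0"
    by (simp add: is_fourier_transform_duality[OF assms(1) p] is_fourier_transform_duality[OF assms(2) p])
  finally have 0: "(LINT w|lebesgue. d w * p w) = 0" .
  have dp: "d w * p w = complex_of_real ((norm (d w))\<^sup>2 * exp (- w\<^sup>2 / 2))" for w
    unfolding of_real_mult complex_norm_square by (simp add: p_def wave_packet_def)
  have "integrable lebesgue (\<lambda>w. d w * p w)"
    using d p by (auto intro: L2_mult_integrable)
  then have int: "integrable lebesgue (\<lambda>w. (norm (d w))\<^sup>2 * exp (- w\<^sup>2 / 2))"
    unfolding dp complex_of_real_integrable_eq .
  have "(LINT w|lebesgue. (norm (d w))\<^sup>2 * exp (- w\<^sup>2 / 2)) = 0"
    using 0 unfolding dp Bochner_Integration.integral_complex_of_real by (simp only: of_real_eq_0_iff)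
  then have "AE w in lebesgue. (norm (d w))\<^sup>2 * exp (- w\<^sup>2 / 2) = 0"
    using integral_nonneg_eq_0_iff_AE[OF int] by simp
  then show ?thesis by eventually_elim (simp add: d_def)
qed

text \<open>
  The integrals in the hypothesis are the values of the Fourier integral of \<open>d\<close> times a Gaussian, which is
  an integrable function.
\<close>
lemma L2_orthogonal_wave_packets:
  assumes d: "d \<in> L2" and 0: "\<And>y. (LINT x|lebesgue. d x * wave_packet 0 1 y x) = 0"
  shows "AE x in lebesgue. d x = 0"
proof -
  have "AE x in lebesgue. d x * wave_packet 0 1 0 x = 0"
  proof (rule L1_fourier_zero_imp_zero)
    show "(\<lambda>x. d x * wave_packet 0 1 0 x) \<in> L1"
      using L2_mult_wave_packet[OF d, of 1] by simp
    fix w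
    have "fourier_integral (\<lambda>x. d x * wave_packet 0 1 0 x) w = (LINT x|lebesgue. d x * wave_packet 0 1 (- w) x)"
      unfolding fourier_integral_def by (simp add: wave_packet_def mult.assoc)
    then show "fourier_integral (\<lambda>x. d x * wave_packet 0 1 0 x) w = 0" by (simp only: 0)
  qed
  then show ?thesis by eventually_elim (simp add: wave_packet_def)
qed

text \<open>
  A Gaussian shifted by \<open>-y\<close> is transformed to a centred Gaussian modulated by \<open>y\<close>, so duality expresses
  the integrals of \<open>f\<close> against the modulated Gaussians through \<open>g\<close> alone.
\<close>
lemma is_fourier_transform_injective:
  assumes "is_fourier_transform f g" "is_fourier_transform f' g"
  shows "AE x in lebesgue. f x = f' x"
proof -
  have f: "f \<in> L2" "f' \<in> L2" using assms by (auto simp: is_fourier_transform_def)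
  have "AE x in lebesgue. f x - f' x = 0"
  proof (rule L2_orthogonal_wave_packets[OF L2_diff[OF f]])
    fix y
    define p where "p = wave_packet (- y) 1 0"
    have p: "p \<in> L1 \<inter> L2" by (simp add: p_def wave_packet_L1 wave_packet_L2)
    have Fp: "fourier_integral p x = complex_of_real (sqrt (2 * pi)) * wave_packet 0 1 y x" for x
      unfolding p_def by (simp add: fourier_wave_packet wave_packet_def mult_ac)
    have *: "(LINT x|lebesgue. h x * wave_packet 0 1 y x) = (LINT w|lebesgue. g w * p w) / complex_of_real (sqrt (2 * pi))"
      if "is_fourier_transform h g" for h
    proof -
      have "(LINT w|lebesgue. g w * p w) = (LINT x|lebesgue. complex_of_real (sqrt (2 * pi)) * (h x * wave_packet 0 1 y x))"
        unfolding is_fourier_transform_duality[OF that p] Fp by (simp only: mult_ac)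
      also have "\<dots> = complex_of_real (sqrt (2 * pi)) * (LINT x|lebesgue. h x * wave_packet 0 1 y x)"
        by (rule integral_mult_right_zero)
      finally show ?thesis by simp
    qed
    have "(LINT x|lebesgue. (f x - f' x) * wave_packet 0 1 y x) =
        (LINT x|lebesgue. f x * wave_packet 0 1 y x) - (LINT x|lebesgue. f' x * wave_packet 0 1 y x)"
      unfolding left_diff_distrib
      by (rule Bochner_Integration.integral_diff) (intro L2_mult_integrable f wave_packet_L2; simp)+
    also have "\<dots> = 0" by (simp only: *[OF assms(1)] *[OF assms(2)] diff_self)
    finally show "(LINT x|lebesgue. (f x - f' x) * wave_packet 0 1 y x) = 0" .
  qed
  then show ?thesis by eventually_elim simp
qed

lemma is_fourier_transform_cong_AE:
  assumes "is_fourier_transform f g" and g': "g' \<in> borel_measurable lebesgue"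
    and ae: "AE w in lebesgue. g w = g' w"
  shows "is_fourier_transform f g'"
proof -
  have g: "g \<in> L2" using assms by (auto simp: is_fourier_transform_def)
  have "(\<integral>\<^sup>+x. ennreal ((norm (g' x))\<^sup>2) \<partial>lebesgue) = (\<integral>\<^sup>+x. ennreal ((norm (g x))\<^sup>2) \<partial>lebesgue)"
    by (intro nn_integral_cong_AE) (use ae in eventually_elim, simp)
  then have "g' \<in> L2" using g g' by (simp add: L2_iff_nn_integral)
  moreover have "(\<integral>\<^sup>+x. ennreal ((norm (u x - g' x))\<^sup>2) \<partial>lebesgue) = (\<integral>\<^sup>+x. ennreal ((norm (u x - g x))\<^sup>2) \<partial>lebesgue)" for u
    by (intro nn_integral_cong_AE) (use ae in eventually_elim, simp)
  ultimately show ?thesis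
    using assms(1) by (simp add: is_fourier_transform_def L2_tendsto_def)
qed

section \<open>Existence and inversion of the Fourier transform\<close>

text \<open>
  The restrictions of \<open>f\<close> to \<open>[-r, r]\<close> are integrable and converge to \<open>f\<close> in \<open>L\<^sup>2\<close>. Along radii \<open>r k\<close> with tails
  at most \<open>4\<^sup>-\<^sup>k\<close> the Plancherel inequality makes their transforms converge geometrically.
\<close>
lemma is_fourier_transform_exists:
  assumes f: "f \<in> L2"
  shows "\<exists>g. is_fourier_transform f g"
proof -
  have [measurable]: "f \<in> borel_measurable lebesgue" using f by (rule L2_measurable)
  define T where "T n x = f x * indicator {- real n..real n} x" for n x
  have T_eq: "T n x = (if \<bar>x\<bar> \<le> real n then f x else 0)" for n x
    by (auto simp: T_def indicator_def)
  have T_meas [measurable]: "T n \<in> borel_measurable lebesgue" for n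
    unfolding T_def[abs_def] by (intro borel_measurable_times borel_measurable_indicator) auto
  have ind: "(indicator {- real n..real n} :: real \<Rightarrow> complex) \<in> L2" for n
  proof -
    have "(\<lambda>x. (norm (indicator {- real n..real n} x :: complex))\<^sup>2) = indicator {- real n..real n}"
      by (auto simp: indicator_def)
    moreover have "(indicator {- real n..real n} :: real \<Rightarrow> complex) \<in> borel_measurable lebesgue"
      by (rule borel_measurable_indicator) auto
    ultimately show ?thesis by (simp add: L2_def)
  qed
  have T: "T n \<in> L1 \<inter> L2" for n
  proof
    show "T n \<in> L1"
      unfolding L1_def mem_Collect_eq T_def[abs_def] by (rule L2_mult_integrable[OF f ind])
    show "T n \<in> L2"
      by (rule L2_norm_le[OF f T_meas]) (simp add: T_eq)
  qed
  let ?e = "\<lambda>n. \<integral>\<^sup>+x. ennreal ((norm (f x - T n x))\<^sup>2) \<partial>lebesgue"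
  have "?e \<longlonglongrightarrow> (\<integral>\<^sup>+x. 0 \<partial>(lebesgue :: real measure))"
  proof (rule nn_integral_dominated_convergence[where w = "\<lambda>x. ennreal ((norm (f x))\<^sup>2)"])
    show "(\<integral>\<^sup>+x. ennreal ((norm (f x))\<^sup>2) \<partial>lebesgue) < \<infinity>"
      using f by (simp add: L2_iff_nn_integral)
    show "AE x in lebesgue. ennreal ((norm (f x - T n x))\<^sup>2) \<le> ennreal ((norm (f x))\<^sup>2)" for n
      by (simp add: T_eq)
    have "(\<lambda>n. ennreal ((norm (f x - T n x))\<^sup>2)) \<longlonglongrightarrow> 0" for x
    proof (rule tendsto_eventually)
      obtain N where "\<bar>x\<bar> \<le> real N" using real_arch_simple by blast
      then show "\<forall>\<^sub>F n in sequentially. ennreal ((norm (f x - T n x))\<^sup>2) = 0"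
        by (intro eventually_sequentiallyI[of N]) (auto simp: T_eq)
    qed
    then show "AE x in lebesgue. (\<lambda>n. ennreal ((norm (f x - T n x))\<^sup>2)) \<longlonglongrightarrow> 0" by simp
  qed measurable
  then have "?e \<longlonglongrightarrow> 0" by simp
  then have "\<forall>k. \<exists>N. \<forall>n\<ge>N. ?e n < ennreal ((1/4) ^ k)"
    unfolding eventually_sequentially[symmetric]
    by (intro allI order_tendstoD(2)[where y = 0] ennreal_less_zero_iff[THEN iffD2] zero_less_power) simp_all
  from choice[OF this] obtain r where r0: "\<forall>k. \<forall>n\<ge>r k. ?e n < ennreal ((1/4) ^ k)"
    by (rule exE)
  have r: "?e n < ennreal ((1/4) ^ k)" if "n \<ge> r k" for k n
    by (rule r0[rule_format, OF that])
  define u where "u k = T (r k)" for k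
  have u: "u k \<in> L1 \<inter> L2" for k unfolding u_def by (rule T)
  have u_cauchy: "(\<integral>\<^sup>+x. ennreal ((norm (u m x - u k x))\<^sup>2) \<partial>lebesgue) \<le> ennreal ((1/4) ^ k)" if "k \<le> m" for k m
  proof -
    \<comment> \<open>The radii need not increase, so the smaller of the two decides where the difference can be nonzero.\<close>
    have "norm (u m x - u k x) \<le> norm (f x - T (min (r m) (r k)) x)" for x
      by (auto simp: u_def T_eq min_def)
    then have "(\<integral>\<^sup>+x. ennreal ((norm (u m x - u k x))\<^sup>2) \<partial>lebesgue) \<le> ?e (min (r m) (r k))"
      by (intro nn_integral_mono ennreal_leI power_mono) auto
    also have "\<dots> \<le> ennreal ((1/4) ^ k)"
    proof (cases "r m \<le> r k")
      case True
      have "?e (r m) \<le> ennreal ((1/4) ^ m)" by (rule less_imp_le[OF r[OF order_refl]])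
      also have "\<dots> \<le> ennreal ((1/4) ^ k)" by (rule ennreal_leI, rule power_decreasing[OF that]) simp_all
      finally show ?thesis using True by (simp add: min_def)
    next
      case False
      have "?e (r k) \<le> ennreal ((1/4) ^ k)" by (rule less_imp_le[OF r[OF order_refl]])
      then show ?thesis using False by (simp add: min_def)
    qed
    finally show ?thesis .
  qed
  define C where "C = ennreal (2 * pi)"
  have C: "C < \<infinity>" by (simp add: C_def)
  have cauchy: "(\<integral>\<^sup>+w. ennreal ((norm (fourier_integral (u m) w - fourier_integral (u k) w))\<^sup>2) \<partial>lebesgue)
      \<le> C * ennreal ((1/4) ^ k)" if "k \<le> m" for k m
  proof -
    define v where "v x = u m x - u k x" for x
    have "v \<in> L1" using u[of m] u[of k] by (auto simp: v_def[abs_def] L1_def)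
    have Fv: "fourier_integral v w = fourier_integral (u m) w - fourier_integral (u k) w" for w
      unfolding v_def fourier_integral_def left_diff_distrib
      by (rule Bochner_Integration.integral_diff[OF integrable_fourier integrable_fourier]) (use u in blast)+
    have "(\<integral>\<^sup>+w. ennreal ((norm (fourier_integral v w))\<^sup>2) \<partial>lebesgue)
      \<le> C * (\<integral>\<^sup>+x. ennreal ((norm (v x))\<^sup>2) \<partial>lebesgue)"
      unfolding C_def by (rule plancherel_le) fact
    also have "\<dots> \<le> C * ennreal ((1/4) ^ k)"
      unfolding v_def by (intro mult_left_mono u_cauchy that) simp
    finally show ?thesis by (simp only: Fv)
  qed
  have "fourier_integral (u k) \<in> borel_measurable lebesgue" for k
    by (rule fourier_integral_measurable) (use u in blast)
  from L2_complete_geometric[OF this C cauchy]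
  obtain g where g [measurable]: "g \<in> borel_measurable lebesgue"
    and g0: "\<forall>k. (\<integral>\<^sup>+w. ennreal ((norm (fourier_integral (u k) w - g w))\<^sup>2) \<partial>lebesgue) \<le> C * ennreal ((1/4) ^ k)"
    by (rule bexE)
  note gk = g0[rule_format]
  have geom: "(\<lambda>k. ennreal ((1/4) ^ k)) \<longlonglongrightarrow> 0"
    unfolding ennreal_0[symmetric] by (intro tendsto_ennrealI LIMSEQ_realpow_zero) auto
  have Cgeom: "(\<lambda>k. C * ennreal ((1/4) ^ k)) \<longlonglongrightarrow> 0"
    using ennreal_tendsto_cmult[OF _ geom, of C] C by simp
  have uf: "L2_tendsto u f"
    unfolding L2_tendsto_def
  proof (rule tendsto_sandwich[OF _ _ tendsto_const geom])
    show "\<forall>\<^sub>F k in sequentially. (\<integral>\<^sup>+x. ennreal ((norm (u k x - f x))\<^sup>2) \<partial>lebesgue) \<le> ennreal ((1/4) ^ k)"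
      using less_imp_le[OF r[OF order_refl]] by (simp add: u_def norm_minus_commute)
  qed simp
  have ug: "L2_tendsto (\<lambda>k. fourier_integral (u k)) g"
    unfolding L2_tendsto_def
    by (rule tendsto_sandwich[OF _ _ tendsto_const Cgeom]) (simp_all add: gk)
  have "g \<in> L2"
  proof -
    have Fu: "fourier_integral (u 0) \<in> L2" using u by (rule fourier_integral_L2)
    have [measurable]: "fourier_integral (u 0) \<in> borel_measurable lebesgue" using Fu by (rule L2_measurable)
    have "(\<lambda>w. fourier_integral (u 0) w - g w) \<in> L2"
      unfolding L2_iff_nn_integral
      using gk[of 0] C by (auto intro: le_less_trans)
    from L2_diff[OF Fu this] show ?thesis by simp
  qed
  with u uf ug f show ?thesis unfolding is_fourier_transform_def by blast
qed

lemma is_fourier_transform_fourier_transform: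
  "f \<in> L2 \<Longrightarrow> is_fourier_transform f (fourier_transform f)"
  unfolding fourier_transform_def by (rule someI_ex[OF is_fourier_transform_exists])

lemma fourier_transform_AE_eqI:
  assumes "is_fourier_transform f g"
  shows "AE w in lebesgue. fourier_transform f w = g w"
  using assms by (intro is_fourier_transform_unique[OF is_fourier_transform_fourier_transform])
    (auto simp: is_fourier_transform_def)

text \<open>
  The candidate \<open>h\<close> has some transform \<open>g\<close>. Moving a modulated Gaussian by duality from \<open>g\<close> to \<open>h\<close>, and then
  from \<open>h1\<close> to the conjugate of \<open>G\<close>, shows that \<open>g\<close> and \<open>G\<close> have the same integrals against all modulated
  Gaussians. Conjugating replaces the reflection \<open>x \<mapsto> -x\<close> of the usual inversion formula, so no change of
  variables is needed.
\<close>
lemma is_fourier_transform_inverse: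
  assumes G: "G \<in> L2" and h1: "is_fourier_transform (\<lambda>w. cnj (G w)) h1"
  shows "is_fourier_transform (\<lambda>x. cnj (h1 x) / complex_of_real (2 * pi)) G"
proof -
  define h where "h x = cnj (h1 x) / complex_of_real (2 * pi)" for x
  have "h1 \<in> L2" using h1 by (simp add: is_fourier_transform_def)
  then have h: "h \<in> L2"
    using L2_cmult[OF L2_cnj, of h1 "1 / complex_of_real (2 * pi)"] by (simp add: h_def[abs_def])
  then obtain g where g: "is_fourier_transform h g"
    using is_fourier_transform_exists by blast
  then have gL2: "g \<in> L2" by (simp add: is_fourier_transform_def)
  define r where "r = complex_of_real (sqrt (2 * pi))"
  have r: "r * r = complex_of_real (2 * pi)" "cnj r = r" "r \<noteq> 0"
    by (simp_all only: r_def of_real_mult[symmetric] real_sqrt_mult_self complex_cnj_complex_of_real) simp_all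
  have "AE w in lebesgue. g w - G w = 0"
  proof (rule L2_orthogonal_wave_packets[OF L2_diff[OF gL2 G]])
    fix y
    let ?M = "wave_packet 0 1 y" and ?P = "wave_packet y 1 0"
    have M: "?M \<in> L1 \<inter> L2" and P: "?P \<in> L1 \<inter> L2"
      by (simp_all add: wave_packet_L1 wave_packet_L2)
    have FM: "fourier_integral ?M x = r * ?P x" for x
      unfolding fourier_wave_packet[OF zero_less_one] wave_packet_def r_def by simp
    have FP: "fourier_integral ?P w = r * cnj (?M w)" for w
      unfolding fourier_wave_packet[OF zero_less_one] wave_packet_def r_def
      by (simp add: exp_cnj mult_ac)
    have cnjP: "cnj (?P x) = ?P x" for x by (simp add: wave_packet_def)
    have "(LINT w|lebesgue. g w * ?M w) = (LINT x|lebesgue. h x * (r * ?P x))"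
      unfolding is_fourier_transform_duality[OF g M] FM ..
    also have "\<dots> = (LINT x|lebesgue. r / complex_of_real (2 * pi) * cnj (h1 x * ?P x))"
      by (intro Bochner_Integration.integral_cong refl) (simp only: h_def complex_cnj_mult cnjP divide_inverse mult_ac)
    also have "\<dots> = r / complex_of_real (2 * pi) * cnj (LINT x|lebesgue. h1 x * ?P x)"
      by (simp only: integral_mult_right_zero Bochner_Integration.integral_cnj)
    also have "(LINT x|lebesgue. h1 x * ?P x) = (LINT w|lebesgue. r * cnj (G w * ?M w))"
      unfolding is_fourier_transform_duality[OF h1 P] FP
      by (intro Bochner_Integration.integral_cong refl) simp
    also have "\<dots> = r * cnj (LINT w|lebesgue. G w * ?M w)"
      by (simp only: integral_mult_right_zero Bochner_Integration.integral_cnj)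
    also have "r / complex_of_real (2 * pi) * cnj (r * cnj (LINT w|lebesgue. G w * ?M w))
        = (LINT w|lebesgue. G w * ?M w)"
      unfolding r(1)[symmetric] complex_cnj_mult complex_cnj_cnj r(2) using r(3) by simp
    finally have "(LINT w|lebesgue. g w * ?M w) = (LINT w|lebesgue. G w * ?M w)" .
    moreover have "(LINT w|lebesgue. (g w - G w) * ?M w) =
        (LINT w|lebesgue. g w * ?M w) - (LINT w|lebesgue. G w * ?M w)"
      unfolding left_diff_distrib
      by (rule Bochner_Integration.integral_diff) (use gL2 G M in \<open>auto intro: L2_mult_integrable\<close>)
    ultimately show "(LINT w|lebesgue. (g w - G w) * ?M w) = 0" by simp
  qed
  then have "AE w in lebesgue. g w = G w" by eventually_elim simp
  then have "is_fourier_transform h G"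
    by (rule is_fourier_transform_cong_AE[OF g L2_measurable[OF G]])
  then show ?thesis by (simp add: h_def[abs_def])
qed

lemma is_fourier_transform_fourier_integral:
  assumes "u \<in> L1 \<inter> L2"
  shows "is_fourier_transform u (fourier_integral u)"
  unfolding is_fourier_transform_def
  using assms fourier_integral_L2[OF assms]
  by (auto intro!: exI[of _ "\<lambda>_. u"] simp: L2_tendsto_def)

text \<open>
  Both sides have the same Fourier transform, and the transform is injective.
\<close>
lemma fourier_inversion:
  assumes f: "f \<in> L2" and T: "fourier_transform f \<in> L1"
  shows "AE x in lebesgue. f x =
    cnj (fourier_integral (\<lambda>w. cnj (fourier_transform f w)) x) / complex_of_real (2 * pi)"
proof (rule is_fourier_transform_injective)
  show FT: "is_fourier_transform f (fourier_transform f)"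
    using f by (rule is_fourier_transform_fourier_transform)
  then have T2: "fourier_transform f \<in> L2" by (simp add: is_fourier_transform_def)
  have "(\<lambda>w. cnj (fourier_transform f w)) \<in> L1 \<inter> L2"
    using T L2_cnj[OF T2] by (simp add: L1_def)
  then show "is_fourier_transform
      (\<lambda>x. cnj (fourier_integral (\<lambda>w. cnj (fourier_transform f w)) x) / complex_of_real (2 * pi))
      (fourier_transform f)"
    by (intro is_fourier_transform_inverse[OF T2] is_fourier_transform_fourier_integral)
qed

section \<open>The Hilbert transform\<close>

text \<open>
  The prescribed transform is square integrable, and every such function is a Fourier transform.
\<close>
lemma is_hilbert_transform_exists:
  assumes f: "f \<in> L2"
  shows "\<exists>h. is_hilbert_transform f h"
proof -
  let ?T = "fourier_transform f"
  define G where "G w = (if w > 0 then - \<i> * ?T w else if w < 0 then \<i> * ?T w else 0)" for w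
  have T: "?T \<in> L2"
    using is_fourier_transform_fourier_transform[OF f] by (simp add: is_fourier_transform_def)
  have [measurable]: "?T \<in> borel_measurable lebesgue" using T by (rule L2_measurable)
  note measurable_ident_lebesgue [measurable]
  have G: "G \<in> L2"
  proof (rule L2_norm_le[OF T])
    show "G \<in> borel_measurable lebesgue" unfolding G_def by measurable
    show "norm (G w) \<le> norm (?T w)" for w by (simp add: G_def norm_mult)
  qed
  obtain h1 where "is_fourier_transform (\<lambda>w. cnj (G w)) h1"
    using is_fourier_transform_exists[OF L2_cnj[OF G]] by blast
  from is_fourier_transform_inverse[OF G this]
  obtain h where h: "is_fourier_transform h G" by blast
  then have "h \<in> L2" by (simp add: is_fourier_transform_def)
  with f fourier_transform_AE_eqI[OF h] have "is_hilbert_transform f h"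
    by (simp add: is_hilbert_transform_def G_def)
  then show ?thesis by blast
qed

lemma is_hilbert_transform_hilbert_transform:
  "f \<in> L2 \<Longrightarrow> is_hilbert_transform f (hilbert_transform f)"
  unfolding hilbert_transform_def by (rule someI_ex[OF is_hilbert_transform_exists])

lemma hilbert_transform_sobolev:
  assumes "f \<in> sobolev \<gamma>"
  shows "hilbert_transform f \<in> sobolev \<gamma>"
proof -
  have H: "is_hilbert_transform f (hilbert_transform f)"
    using assms by (intro is_hilbert_transform_hilbert_transform) (simp add: sobolev_def)
  then have ae: "AE w in lebesgue. norm (fourier_transform (hilbert_transform f) w) \<le> norm (fourier_transform f w)"
    unfolding is_hilbert_transform_def by (elim conjE AE_mp) (simp add: norm_mult)
  have "(\<integral>\<^sup>+w. ennreal ((1 + \<bar>w\<bar>\<^sup>2) powr \<gamma> * (norm (fourier_transform (hilbert_transform f) w))\<^sup>2) \<partial>lebesgue)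
     \<le> (\<integral>\<^sup>+w. ennreal ((1 + \<bar>w\<bar>\<^sup>2) powr \<gamma> * (norm (fourier_transform f w))\<^sup>2) \<partial>lebesgue)"
    by (intro nn_integral_mono_AE, use ae in eventually_elim)
       (intro ennreal_leI mult_left_mono power_mono; simp)
  then show ?thesis
    using assms H by (auto simp: sobolev_def is_hilbert_transform_def intro: le_less_trans)
qed

section \<open>Sobolev functions are differentiable\<close>

text \<open>
  For \<open>|x| \<ge> 1\<close> the function is at most \<open>|x|\<close> to the power \<open>-2s < -1\<close>; elsewhere it is at most \<open>1\<close>.
\<close>
lemma integrable_Japanese_bracket_powr:
  assumes s: "s > 1 / 2"
  shows "integrable lebesgue (\<lambda>x::real. (1 + x\<^sup>2) powr - s)"
proof (rule Bochner_Integration.integrable_bound)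
  define p where "p x = indicator {1..} x * x powr - (2 * s)" for x :: real
  have [measurable]: "p \<in> borel_measurable borel" unfolding p_def by measurable
  have "((\<lambda>x. x powr - (2 * s)) has_integral -(1 powr (- (2 * s) + 1)) / (- (2 * s) + 1)) {1::real..}"
    using s by (intro has_integral_powr_to_inf) auto
  then have "set_integrable lebesgue {1::real..} (\<lambda>x. x powr - (2 * s))"
    by (intro nonnegative_absolutely_integrable_1) (auto simp: integrable_on_def)
  then have "integrable lebesgue p"
    by (simp add: set_integrable_def p_def[abs_def])
  then have p: "integrable lborel p"
    by (simp add: integrable_completion)
  then have p': "integrable lborel (\<lambda>x. p (- x))"
    using lborel_integrable_real_affine[OF p, of "-1" 0] by simp
  have "integrable lborel (indicator {-1..1} :: real \<Rightarrow> real)" by simp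
  with p p' have "integrable lborel (\<lambda>x. indicator {-1..1} x + p x + p (- x))"
    by (intro Bochner_Integration.integrable_add)
  then show "integrable lebesgue (\<lambda>x. indicator {-1..1} x + p x + p (- x))"
    by (subst integrable_completion) auto
  show "(\<lambda>x::real. (1 + x\<^sup>2) powr - s) \<in> borel_measurable lebesgue"
    by (rule borel_imp_lebesgue_measurable) measurable
  have big: "(1 + x\<^sup>2) powr - s \<le> \<bar>x\<bar> powr - (2 * s)" if "\<bar>x\<bar> \<ge> 1" for x :: real
  proof -
    have "(1 + x\<^sup>2) powr - s \<le> (x\<^sup>2) powr - s"
      using that s by (intro powr_mono2') auto
    also have "(x\<^sup>2) powr - s = (\<bar>x\<bar> powr 2) powr - s"
      using that by (subst powr_numeral) auto
    also have "(\<bar>x\<bar> powr 2) powr - s = \<bar>x\<bar> powr - (2 * s)"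
      by (simp only: powr_powr mult_minus_right)
    finally show ?thesis .
  qed
  have small: "(1 + x\<^sup>2) powr - s \<le> 1" for x :: real
  proof -
    have "(1 + x\<^sup>2) powr - s \<le> (1 + x\<^sup>2) powr 0"
      using s by (intro powr_mono) auto
    then show ?thesis by (simp add: powr_zero_eq_one split: if_splits)
  qed
  have le: "(1 + x\<^sup>2) powr - s \<le> indicator {-1..1} x + p x + p (- x)" for x :: real
  proof (cases "\<bar>x\<bar> \<le> 1")
    case True
    then have "1 \<le> indicator {-1..1} x + p x + p (- x)"
      by (auto simp: p_def indicator_def)
    with small[of x] show ?thesis by linarith
  next
    case False
    then have "indicator {-1..1} x + p x + p (- x) = \<bar>x\<bar> powr - (2 * s)"
      by (auto simp: p_def indicator_def)
    with big[of x] False show ?thesis by linarith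
  qed
  have "norm ((1 + x\<^sup>2) powr - s) \<le> norm (indicator {-1..1} x + p x + p (- x))" for x :: real
    using order_trans[OF le[of x] abs_ge_self] by simp
  then show "AE x in lebesgue. norm ((1 + x\<^sup>2) powr - s) \<le> norm (indicator {-1..1} x + p x + p (- x))"
    by (rule AE_I2)
qed

text \<open>
  With \<open>q = 1 + w\<^sup>2\<close> and \<open>T\<close> the transform, \<open>|w\<^sup>k T|\<close> is the product of \<open>a = q\<^bsup>\<gamma>/2\<^esup> |T|\<close> and
  \<open>b = |w|\<^sup>k q\<^bsup>-\<gamma>/2\<^esup>\<close>. Here \<open>a\<^sup>2\<close> is integrable because \<open>f\<close> is in the Sobolev space, and
  \<open>b\<^sup>2 \<le> q\<^bsup>n-\<gamma>\<^esup>\<close> is integrable because \<open>\<gamma> - n > 1/2\<close>.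
\<close>
lemma sobolev_moment_L1:
  assumes f: "f \<in> sobolev \<gamma>" and g: "\<gamma> > real n + 1 / 2" and k: "k \<le> n"
  shows "(\<lambda>w. complex_of_real w ^ k * fourier_transform f w) \<in> L1"
proof -
  let ?T = "fourier_transform f"
  have "is_fourier_transform f ?T"
    using f by (intro is_fourier_transform_fourier_transform) (simp add: sobolev_def)
  then have T [measurable]: "?T \<in> borel_measurable lebesgue"
    by (auto simp: is_fourier_transform_def intro: L2_measurable)
  have b: "(\<lambda>w::real. (1 + w\<^sup>2) powr \<gamma>) \<in> borel_measurable lebesgue"
    by (rule borel_imp_lebesgue_measurable) measurable
  have c: "(\<lambda>w. complex_of_real w ^ k) \<in> borel_measurable lebesgue"
    by (rule borel_imp_lebesgue_measurable) measurable
  have 1: "integrable lebesgue (\<lambda>w. (1 + w\<^sup>2) powr \<gamma> * (norm (?T w))\<^sup>2)"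
    unfolding integrable_iff_bounded
  proof
    show "(\<lambda>w. (1 + w\<^sup>2) powr \<gamma> * (norm (?T w))\<^sup>2) \<in> borel_measurable lebesgue"
      using b by (rule borel_measurable_times) measurable
    show "(\<integral>\<^sup>+w. ennreal (norm ((1 + w\<^sup>2) powr \<gamma> * (norm (?T w))\<^sup>2)) \<partial>lebesgue) < \<infinity>"
      using f by (simp add: sobolev_def)
  qed
  have 2: "integrable lebesgue (\<lambda>w::real. (1 + w\<^sup>2) powr - (\<gamma> - real n))"
    using g by (intro integrable_Japanese_bracket_powr) simp
  have "norm (complex_of_real w ^ k * ?T w) \<le> (1 + w\<^sup>2) powr \<gamma> * (norm (?T w))\<^sup>2 + (1 + w\<^sup>2) powr - (\<gamma> - real n)" for w
  proof -
    define q where "q = 1 + w\<^sup>2"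
    have q: "q \<ge> 1" by (simp add: q_def)
    define a where "a = q powr (\<gamma> / 2) * norm (?T w)"
    define b where "b = \<bar>w\<bar> ^ k * q powr - (\<gamma> / 2)"
    have "norm (complex_of_real w ^ k * ?T w) = a * b * (q powr 0)"
      using q by (simp add: a_def b_def norm_mult norm_power powr_minus field_simps)
    also have "\<dots> = a * b" using q by simp
    also have "\<dots> \<le> a\<^sup>2 + b\<^sup>2"
    proof -
      have "0 \<le> a * b" by (simp add: a_def b_def)
      with sum_squares_bound[of a b] show ?thesis by linarith
    qed
    also have "a\<^sup>2 = q powr \<gamma> * (norm (?T w))\<^sup>2"
      using q by (simp add: a_def power_mult_distrib flip: powr_numeral) (simp add: powr_powr)
    also have "b\<^sup>2 \<le> q powr - (\<gamma> - real n)"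
    proof -
      have "b\<^sup>2 = (\<bar>w\<bar> ^ k)\<^sup>2 * (q powr - (\<gamma> / 2))\<^sup>2" by (simp add: b_def power_mult_distrib)
      also have "(q powr - (\<gamma> / 2))\<^sup>2 = q powr - \<gamma>"
        using q by (simp add: powr_powr flip: powr_numeral)
      also have "(\<bar>w\<bar> ^ k)\<^sup>2 = (w\<^sup>2) ^ k" by (simp add: power_mult[symmetric] mult.commute power_even_abs)
      also have "(w\<^sup>2) ^ k * q powr - \<gamma> \<le> q ^ n * q powr - \<gamma>"
      proof (intro mult_right_mono)
        have "(w\<^sup>2) ^ k \<le> q ^ k" by (intro power_mono) (auto simp: q_def)
        also have "\<dots> \<le> q ^ n" using q k by (rule power_increasing[rotated])
        finally show "(w\<^sup>2) ^ k \<le> q ^ n" .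
      qed simp
      also have "q ^ n = q powr real n" using q by (simp add: powr_realpow)
      also have "q powr real n * q powr - \<gamma> = q powr - (\<gamma> - real n)"
        by (simp add: powr_add[symmetric])
      finally show ?thesis .
    qed
    finally show ?thesis by (simp add: q_def)
  qed
  then have le: "norm (complex_of_real w ^ k * ?T w) \<le> norm ((1 + w\<^sup>2) powr \<gamma> * (norm (?T w))\<^sup>2 + (1 + w\<^sup>2) powr - (\<gamma> - real n))" for w
    by (rule order_trans) simp
  show ?thesis unfolding L1_def mem_Collect_eq
  proof (rule Bochner_Integration.integrable_bound[OF Bochner_Integration.integrable_add[OF 1 2]])
    show "(\<lambda>w. complex_of_real w ^ k * ?T w) \<in> borel_measurable lebesgue"
      using c T by (rule borel_measurable_times)
  qed (use le in simp)
qed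

lemma fourier_integral_continuous:
  assumes g: "g \<in> L1"
  shows "continuous_on UNIV (fourier_integral g)"
  unfolding continuous_on_sequentially comp_def
proof (intro ballI allI impI, elim conjE)
  fix X :: "nat \<Rightarrow> real" and x assume X: "X \<longlonglongrightarrow> x"
  have m: "(\<lambda>w. g w * exp (- \<i> * complex_of_real y * complex_of_real w)) \<in> borel_measurable lebesgue" for y
    using integrable_fourier[OF g] by (rule borel_measurable_integrable)
  show "(\<lambda>n. fourier_integral g (X n)) \<longlonglongrightarrow> fourier_integral g x"
    unfolding fourier_integral_def
  proof (rule integral_dominated_convergence[where w = "\<lambda>w. norm (g w)"])
    show "integrable lebesgue (\<lambda>w. norm (g w))" using g by (simp add: L1_def)
    show "AE w in lebesgue. (\<lambda>n. g w * exp (- \<i> * complex_of_real (X n) * complex_of_real w)) \<longlonglongrightarrow>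
        g w * exp (- \<i> * complex_of_real x * complex_of_real w)"
      by (intro AE_I2 tendsto_intros X)
    show "AE w in lebesgue. norm (g w * exp (- \<i> * complex_of_real (X n) * complex_of_real w)) \<le> norm (g w)" for n
      by (simp add: norm_mult)
  qed (fact m)+
qed

text \<open>
  Up to sign, the difference quotient minus the expected derivative is the integral of \<open>q n\<close>, which tends to \<open>0\<close>
  pointwise by the second order bound on \<open>exp\<close> and is dominated by \<open>2 |w g w|\<close> by the first order bound.
\<close>
lemma fourier_integral_has_vector_derivative:
  assumes g: "g \<in> L1" and wg: "(\<lambda>w. complex_of_real w * g w) \<in> L1"
  shows "(fourier_integral g has_vector_derivative
      fourier_integral (\<lambda>w. - \<i> * complex_of_real w * g w) x) (at x)"
  unfolding has_vector_derivative_def has_derivative_at tendsto_at_iff_sequentially comp_def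
proof (intro conjI allI impI bounded_linear_scaleR_left)
  let ?D = "fourier_integral (\<lambda>w. - \<i> * complex_of_real w * g w) x"
  have wg': "(\<lambda>w. - \<i> * complex_of_real w * g w) \<in> L1"
    using integrable_mult_right[of "- \<i>" lebesgue "\<lambda>w. complex_of_real w * g w"] wg
    by (simp add: L1_def mult.assoc)
  fix h :: "nat \<Rightarrow> real" assume "\<forall>i. h i \<in> UNIV - {0}" and h0: "h \<longlonglongrightarrow> 0"
  then have h: "h n \<noteq> 0" for n by auto
  let ?k = "\<lambda>y w. exp (- \<i> * complex_of_real y * complex_of_real w)"
  define q where "q n w = (g w * ?k (x + h n) w - g w * ?k x w
      - complex_of_real (h n) * (- \<i> * complex_of_real w * g w * ?k x w)) / complex_of_real \<bar>h n\<bar>" for n w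
  have q_int: "integrable lebesgue (q n)" for n
    unfolding q_def by (intro integrable_divide_zero Bochner_Integration.integrable_diff
        integrable_mult_right integrable_fourier g wg')
  have q: "norm (fourier_integral g (x + h n) - fourier_integral g x - h n *\<^sub>R ?D) / norm (h n)
      = norm (LINT w|lebesgue. q n w)" for n
  proof -
    have "(LINT w|lebesgue. q n w) =
        (fourier_integral g (x + h n) - fourier_integral g x - complex_of_real (h n) * ?D) / complex_of_real \<bar>h n\<bar>"
      unfolding q_def fourier_integral_def
      by (simp only: integral_divide_zero integral_mult_right_zero Bochner_Integration.integral_diff
          Bochner_Integration.integrable_diff integrable_mult_right integrable_fourier g wg')
    then show ?thesis by (simp add: norm_divide scaleR_conv_of_real)
  qed
  have q_eq: "norm (q n w) = norm (g w) * norm (iexp (- (h n * w)) - 1 - \<i> * complex_of_real (- (h n * w))) / \<bar>h n\<bar>" for n w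
  proof -
    have "?k (x + h n) w = ?k x w * iexp (- (h n * w))"
      unfolding exp_add[symmetric] by (rule arg_cong[where f=exp]) (simp add: algebra_simps)
    then have "q n w = g w * ?k x w * (iexp (- (h n * w)) - 1 - \<i> * complex_of_real (- (h n * w))) / complex_of_real \<bar>h n\<bar>"
      unfolding q_def by (simp add: algebra_simps)
    then show ?thesis by (simp add: norm_mult norm_divide del: of_real_minus)
  qed
  have "(\<lambda>n. LINT w|lebesgue. q n w) \<longlonglongrightarrow> (LINT w|(lebesgue::real measure). 0)"
  proof (rule integral_dominated_convergence[where w = "\<lambda>w. 2 * norm (complex_of_real w * g w)"])
    show "integrable lebesgue (\<lambda>w. 2 * norm (complex_of_real w * g w))"
      using wg by (simp add: L1_def del: of_real_mult norm_mult)
    have "(\<lambda>n. q n w) \<longlonglongrightarrow> 0" for w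
    proof (rule Lim_null_comparison)
      have "norm (q n w) \<le> norm (g w) * (w\<^sup>2 / 2 * \<bar>h n\<bar>)" for n
      proof -
        have "norm (iexp (- (h n * w)) - 1 - \<i> * complex_of_real (- (h n * w))) \<le> (h n * w)\<^sup>2 / 2"
          using iexp_approx1[of "- (h n * w)" 1] by (simp add: power2_eq_square abs_mult algebra_simps)
        then have "norm (q n w) \<le> norm (g w) * ((h n * w)\<^sup>2 / 2) / \<bar>h n\<bar>"
          unfolding q_eq by (intro divide_right_mono mult_left_mono) auto
        also have "(h n * w)\<^sup>2 = \<bar>h n\<bar> * \<bar>h n\<bar> * w\<^sup>2" by (simp add: power_mult_distrib power2_eq_square)
        also have "norm (g w) * (\<bar>h n\<bar> * \<bar>h n\<bar> * w\<^sup>2 / 2) / \<bar>h n\<bar> = norm (g w) * (w\<^sup>2 / 2 * \<bar>h n\<bar>)"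
        proof -
          have "a * (t * t * b / 2) / t = a * (b / 2 * t)" if "t \<noteq> 0" for a b t :: real
            using that by (simp add: field_simps)
          then show ?thesis using h[of n] by (simp only: abs_eq_0 not_False_eq_True)
        qed
        finally show ?thesis .
      qed
      then show "\<forall>\<^sub>F n in sequentially. norm (q n w) \<le> norm (g w) * (w\<^sup>2 / 2 * \<bar>h n\<bar>)" by simp
      show "(\<lambda>n. norm (g w) * (w\<^sup>2 / 2 * \<bar>h n\<bar>)) \<longlonglongrightarrow> 0"
        using tendsto_mult_left[OF tendsto_mult_left[OF tendsto_rabs_zero[OF h0], of "w\<^sup>2 / 2"], of "norm (g w)"] by simp
    qed
    then show "AE w in lebesgue. (\<lambda>n. q n w) \<longlonglongrightarrow> 0" by simp
    have "norm (q n w) \<le> 2 * norm (complex_of_real w * g w)" for n w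
    proof -
      have "norm (iexp (- (h n * w)) - 1 - \<i> * complex_of_real (- (h n * w))) \<le>
          norm (iexp (- (h n * w)) - 1) + norm (\<i> * complex_of_real (- (h n * w)))"
        by (rule norm_triangle_ineq4)
      also have "\<dots> \<le> \<bar>h n * w\<bar> + \<bar>h n * w\<bar>"
        using iexp_approx1[of "- (h n * w)" 0] by (intro add_mono) (simp_all add: norm_mult)
      finally have "norm (q n w) \<le> norm (g w) * (\<bar>h n * w\<bar> + \<bar>h n * w\<bar>) / \<bar>h n\<bar>"
        unfolding q_eq by (intro divide_right_mono mult_left_mono) auto
      then show ?thesis using h[of n] by (simp add: norm_mult abs_mult field_simps)
    qed
    then show "AE w in lebesgue. norm (q n w) \<le> 2 * norm (complex_of_real w * g w)" for n by simp
  qed (simp_all add: borel_measurable_integrable[OF q_int])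
  then have "(\<lambda>n. norm (LINT w|lebesgue. q n w)) \<longlonglongrightarrow> 0"
    by (simp add: tendsto_norm_zero)
  then show "(\<lambda>n. norm (fourier_integral g (x + h n) - fourier_integral g x - h n *\<^sub>R ?D) / norm (h n)) \<longlonglongrightarrow> 0"
    by (simp only: q)
qed

lemma fourier_integral_n_times_continuously_differentiable:
  assumes g: "\<And>k. k \<le> n \<Longrightarrow> (\<lambda>w. complex_of_real w ^ k * g w) \<in> L1"
  shows "n_times_continuously_differentiable n (fourier_integral g)"
proof -
  define G where "G k w = (- \<i> * complex_of_real w) ^ k * g w" for k w
  have G_eq: "G k = (\<lambda>w. (- \<i>) ^ k * (complex_of_real w ^ k * g w))" for k
    by (simp only: G_def[abs_def] power_mult_distrib mult.assoc)
  have G: "G k \<in> L1" if "k \<le> n" for k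
    using integrable_mult_right[of "(- \<i>) ^ k" lebesgue "\<lambda>w. complex_of_real w ^ k * g w"] g[OF that]
    unfolding L1_def mem_Collect_eq G_eq by blast
  have wG: "(\<lambda>w. complex_of_real w * G k w) \<in> L1" if "k < n" for k
  proof -
    have "(\<lambda>w. complex_of_real w * G k w) = (\<lambda>w. (- \<i>) ^ k * (complex_of_real w ^ Suc k * g w))"
      unfolding G_eq by (simp add: mult_ac)
    then show ?thesis
      using integrable_mult_right[of "(- \<i>) ^ k" lebesgue "\<lambda>w. complex_of_real w ^ Suc k * g w"] g[of "Suc k"] that
      unfolding L1_def mem_Collect_eq by simp
  qed
  have step: "(\<lambda>w. - \<i> * complex_of_real w * G k w) = G (Suc k)" for k
    by (simp add: G_def[abs_def] mult_ac)
  show ?thesis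
    unfolding n_times_continuously_differentiable_def
  proof (intro exI[of _ "\<lambda>k. fourier_integral (G k)"] conjI allI impI)
    show "fourier_integral (G 0) = fourier_integral g" by (simp add: G_def[abs_def])
    show "(fourier_integral (G k) has_vector_derivative fourier_integral (G (Suc k)) x) (at x)" if "k < n" for k x
      using fourier_integral_has_vector_derivative[OF G wG, of k x] that unfolding step by simp
    show "continuous_on UNIV (fourier_integral (G k))" if "k \<le> n" for k
      by (rule fourier_integral_continuous[OF G[OF that]])
  qed
qed

lemma n_times_continuously_differentiable_bounded_linear:
  assumes f: "n_times_continuously_differentiable n f" and L: "bounded_linear L"
  shows "n_times_continuously_differentiable n (\<lambda>x. L (f x))"
proof -
  obtain D where D: "D 0 = f" "\<And>k x. k < n \<Longrightarrow> (D k has_vector_derivative D (Suc k) x) (at x)"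
    "\<And>k. k \<le> n \<Longrightarrow> continuous_on UNIV (D k)"
    using f unfolding n_times_continuously_differentiable_def by blast
  show ?thesis
    unfolding n_times_continuously_differentiable_def
    by (intro exI[of _ "\<lambda>k x. L (D k x)"])
       (auto simp: D(1) intro: bounded_linear.has_vector_derivative[OF L D(2)] bounded_linear.continuous_on[OF L D(3)])
qed

text \<open>
  The inversion formula exhibits the smooth representative: all moments up to order \<open>n\<close> of the transform
  are integrable.
\<close>
lemma sobolev_embedding:
  assumes f: "f \<in> sobolev \<gamma>" and g: "\<gamma> > real n + 1 / 2"
  shows "\<exists>f'. n_times_continuously_differentiable n f' \<and> (AE x in lebesgue. f x = f' x)"
proof -
  let ?T = "fourier_transform f"
  define L where "L z = cnj z / complex_of_real (2 * pi)" for z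
  have L: "bounded_linear L"
    unfolding L_def by (intro bounded_linear_compose[OF bounded_linear_divide bounded_linear_cnj])
  have "(\<lambda>w. complex_of_real w ^ k * cnj (?T w)) \<in> L1" if "k \<le> n" for k
  proof -
    have "integrable lebesgue (\<lambda>w. cnj (complex_of_real w ^ k * ?T w))"
      using sobolev_moment_L1[OF f g that] unfolding L1_def mem_Collect_eq
      by (rule integrable_bounded_linear[OF bounded_linear_cnj])
    then show ?thesis unfolding L1_def by simp
  qed
  then have "n_times_continuously_differentiable n (fourier_integral (\<lambda>w. cnj (?T w)))"
    by (rule fourier_integral_n_times_continuously_differentiable)
  then have "n_times_continuously_differentiable n (\<lambda>x. L (fourier_integral (\<lambda>w. cnj (?T w)) x))"
    using L by (rule n_times_continuously_differentiable_bounded_linear)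
  moreover have "AE x in lebesgue. f x = L (fourier_integral (\<lambda>w. cnj (?T w)) x)"
    unfolding L_def
  proof (rule fourier_inversion)
    show "f \<in> L2" using f by (simp add: sobolev_def)
    show "?T \<in> L1" using sobolev_moment_L1[OF f g, of 0] by simp
  qed
  ultimately show ?thesis by blast
qed

theorem proposition3p3:
  fixes \<gamma> :: real and \<psi> :: "real \<Rightarrow> complex"
  assumes "\<gamma> \<ge> 0"
    and "\<psi> \<in> sobolev \<gamma>"
  shows "hilbert_transform \<psi> \<in> sobolev \<gamma> \<and>
    (\<forall>n::nat. \<gamma> > real n + 1/2 \<longrightarrow>
      (\<exists>f. n_times_continuously_differentiable n f \<and> (AE x in lebesgue. \<psi> x = f x)) \<and>
      (\<exists>g. n_times_continuously_differentiable n g \<and>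
           (AE x in lebesgue. hilbert_transform \<psi> x = g x)))"
  using hilbert_transform_sobolev[OF assms(2)] sobolev_embedding[OF assms(2)]
    sobolev_embedding[OF hilbert_transform_sobolev[OF assms(2)]] by blast

end
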